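(* There exists a non-Cevian bounded completely normal distributive lattice $\mathbf{B}'$ with countably based differences, of cardinality $\aleph_2$. Hence, $\mathbf{B}'$ is not a homomorphic image of $\mathrm{Cs}_{c}\,G$ for any $\ell$-group $G$, nor of $\mathrm{Id}_{c}\,G$ for any representable $\ell$-group $G$.
   Context: A distributive lattice $D$ with zero is *completely normal* if for all $x,y\in D$ there are $u,v\in D$ with $x\le y\vee u$, $y\le x\vee v$, $u\wedge v=0$. It has *countably based differences* if for all $a,b\in D$ the set $\{x\in D\mid a\le b\vee x\}$ has a countable (i.e. at most countable) coinitial subset, where a subset $Y$ of a poset $Q$ is coinitial if every element of $Q$ is above some element of $Y$. A binary operation $\smallsetminus$ on $D$ is *Cevian* if for all $x,y,z\in D$: $x\le y\vee(x\smallsetminus y)$; $(x\smallsetminus y)\wedge(y\smallsetminus x)=0$; $x\smallsetminus z\le(x\smallsetminus y)\vee(y\smallsetminus z)$. A distributive lattice with zero is *Cevian* if it has a Cevian operation. An $\ell$-group is a (not necessarily Abelian) lattice-ordered group. It is *representable* if it is a subdirect product of totally ordered groups. $\mathrm{Cs}_{c}\,G$ is the lattice, under inclusion, of all finitely generated convex $\ell$-subgroups of $G$. $\mathrm{Id}_{c}\,G$ is the poset, under inclusion, of all finitely generated $\ell$-ideals (normal convex $\ell$-subgroups) of $G$; it is a lattice when $G$ is representable. Homomorphic images are images under surjective lattice homomorphisms. *)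

theory Defs
  imports
    "HOL-Algebra.Lattice"
    "HOL-Algebra.Coset"
    "HOL-Algebra.Product_Groups"
    "HOL-Library.Countable_Set"
begin

section \<open>Distributive lattices with zero\<close>

locale distributive_lattice_zero = lattice + weak_partial_order_bottom +
  assumes meet_join_distrib:
    "\<lbrakk>x \<in> carrier L; y \<in> carrier L; z \<in> carrier L\<rbrakk>
      \<Longrightarrow> x \<sqinter> (y \<squnion> z) = (x \<sqinter> y) \<squnion> (x \<sqinter> z)"

definition completely_normal :: "'a gorder \<Rightarrow> bool" where
  "completely_normal D \<longleftrightarrow> distributive_lattice_zero D \<and>
    (\<forall>x\<in>carrier D. \<forall>y\<in>carrier D. \<exists>u\<in>carrier D. \<exists>v\<in>carrier D.
      x \<sqsubseteq>\<^bsub>D\<^esub> y \<squnion>\<^bsub>D\<^esub> u \<and> y \<sqsubseteq>\<^bsub>D\<^esub> x \<squnion>\<^bsub>D\<^esub> v \<and> u \<sqinter>\<^bsub>D\<^esub> v = \<bottom>\<^bsub>D\<^esub>)"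

definition coinitial :: "'a gorder \<Rightarrow> 'a set \<Rightarrow> 'a set \<Rightarrow> bool" where
  "coinitial D Q Y \<longleftrightarrow> Y \<subseteq> Q \<and> (\<forall>q\<in>Q. \<exists>y\<in>Y. y \<sqsubseteq>\<^bsub>D\<^esub> q)"

definition countably_based_differences :: "'a gorder \<Rightarrow> bool" where
  "countably_based_differences D \<longleftrightarrow>
    (\<forall>a\<in>carrier D. \<forall>b\<in>carrier D.
      \<exists>Y. countable Y \<and> coinitial D {x \<in> carrier D. a \<sqsubseteq>\<^bsub>D\<^esub> b \<squnion>\<^bsub>D\<^esub> x} Y)"

definition cevian_operation :: "'a gorder \<Rightarrow> ('a \<Rightarrow> 'a \<Rightarrow> 'a) \<Rightarrow> bool" where
  "cevian_operation D d \<longleftrightarrow>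
    (\<forall>x\<in>carrier D. \<forall>y\<in>carrier D. d x y \<in> carrier D) \<and>
    (\<forall>x\<in>carrier D. \<forall>y\<in>carrier D. x \<sqsubseteq>\<^bsub>D\<^esub> y \<squnion>\<^bsub>D\<^esub> d x y) \<and>
    (\<forall>x\<in>carrier D. \<forall>y\<in>carrier D. d x y \<sqinter>\<^bsub>D\<^esub> d y x = \<bottom>\<^bsub>D\<^esub>) \<and>
    (\<forall>x\<in>carrier D. \<forall>y\<in>carrier D. \<forall>z\<in>carrier D. d x z \<sqsubseteq>\<^bsub>D\<^esub> d x y \<squnion>\<^bsub>D\<^esub> d y z)"

definition cevian :: "'a gorder \<Rightarrow> bool" where
  "cevian D \<longleftrightarrow> distributive_lattice_zero D \<and> (\<exists>d. cevian_operation D d)"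

definition lattice_hom :: "'a gorder \<Rightarrow> 'b gorder \<Rightarrow> ('a \<Rightarrow> 'b) \<Rightarrow> bool" where
  "lattice_hom L M h \<longleftrightarrow> h \<in> carrier L \<rightarrow> carrier M \<and> join_pres L M h \<and> meet_pres L M h"

definition homomorphic_image :: "'b gorder \<Rightarrow> 'a gorder \<Rightarrow> bool" where
  "homomorphic_image M L \<longleftrightarrow> (\<exists>h. lattice_hom L M h \<and> h ` carrier L = carrier M)"

text \<open>\<^term>\<open>natLeq\<close> has cardinality aleph-zero and \<^term>\<open>cardSuc\<close> is the successor cardinal.\<close>

definition has_card_aleph2 :: "'a set \<Rightarrow> bool" where
  "has_card_aleph2 A \<longleftrightarrow> (card_of A, cardSuc (cardSuc natLeq)) \<in> ordIso"


section \<open>Lattice-ordered groups\<close>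

text \<open>Groups are written multiplicatively and need not be commutative.\<close>

record 'a lgroup = "'a monoid" +
  leq :: "'a \<Rightarrow> 'a \<Rightarrow> bool" (infixl \<open>\<preceq>\<index>\<close> 50)

definition order_of :: "'a lgroup \<Rightarrow> 'a gorder" where
  "order_of G = \<lparr>carrier = carrier G, eq = (=), le = leq G\<rparr>"

locale l_group = group G for G :: "'a lgroup" (structure) +
  assumes lattice_order: "lattice (order_of G)"
    and mult_left_mono:
      "\<lbrakk>x \<in> carrier G; y \<in> carrier G; z \<in> carrier G; x \<preceq> y\<rbrakk> \<Longrightarrow> z \<otimes> x \<preceq> z \<otimes> y"
    and mult_right_mono:
      "\<lbrakk>x \<in> carrier G; y \<in> carrier G; z \<in> carrier G; x \<preceq> y\<rbrakk> \<Longrightarrow> x \<otimes> z \<preceq> y \<otimes> z"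

definition totally_ordered_group :: "'a lgroup \<Rightarrow> bool" where
  "totally_ordered_group G \<longleftrightarrow> l_group G \<and> total_order (order_of G)"

definition l_group_hom :: "'a lgroup \<Rightarrow> 'b lgroup \<Rightarrow> ('a \<Rightarrow> 'b) \<Rightarrow> bool" where
  "l_group_hom G H f \<longleftrightarrow> f \<in> hom G H \<and> lattice_hom (order_of G) (order_of H) f"

definition product_lgroup :: "'i set \<Rightarrow> ('i \<Rightarrow> 'a lgroup) \<Rightarrow> ('i \<Rightarrow> 'a) lgroup" where
  "product_lgroup I T =
    \<lparr>carrier = carrier (product_group I T),
     monoid.mult = monoid.mult (product_group I T),
     one = one (product_group I T),
     leq = (\<lambda>x y. \<forall>i\<in>I. x i \<preceq>\<^bsub>T i\<^esub> y i)\<rparr>"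

definition subdirect_product :: "'a lgroup \<Rightarrow> 'i set \<Rightarrow> ('i \<Rightarrow> 'b lgroup) \<Rightarrow> bool" where
  "subdirect_product G I T \<longleftrightarrow>
    (\<exists>e. l_group_hom G (product_lgroup I T) e \<and> inj_on e (carrier G) \<and>
      (\<forall>i\<in>I. (\<lambda>x. e x i) ` carrier G = carrier (T i)))"

text \<open>
  The types of the index set and of the factors are no restriction. Each factor of a subdirect
  product is isomorphic to the quotient of \<open>G\<close> by the kernel of the projection, whose elements
  are cosets, and factors with the same kernel are redundant, so that the kernels themselves
  can serve as indices.
\<close>

definition representable :: "'a lgroup \<Rightarrow> bool" where
  "representable G \<longleftrightarrow> l_group G \<and>
    (\<exists>(I :: 'a set set) (T :: 'a set \<Rightarrow> 'a set lgroup).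
      (\<forall>i\<in>I. totally_ordered_group (T i)) \<and> subdirect_product G I T)"

definition convex_l_subgroup :: "'a set \<Rightarrow> 'a lgroup \<Rightarrow> bool" where
  "convex_l_subgroup H G \<longleftrightarrow> subgroup H G \<and>
    (\<forall>x\<in>H. \<forall>y\<in>H. x \<squnion>\<^bsub>order_of G\<^esub> y \<in> H \<and> x \<sqinter>\<^bsub>order_of G\<^esub> y \<in> H) \<and>
    (\<forall>x\<in>H. \<forall>z\<in>H. \<forall>y\<in>carrier G. x \<preceq>\<^bsub>G\<^esub> y \<and> y \<preceq>\<^bsub>G\<^esub> z \<longrightarrow> y \<in> H)"

definition l_ideal :: "'a set \<Rightarrow> 'a lgroup \<Rightarrow> bool" where
  "l_ideal H G \<longleftrightarrow> convex_l_subgroup H G \<and> H \<lhd> G"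

definition convex_l_subgroup_generated :: "'a lgroup \<Rightarrow> 'a set \<Rightarrow> 'a set" where
  "convex_l_subgroup_generated G X = \<Inter> {H. convex_l_subgroup H G \<and> X \<subseteq> H}"

definition l_ideal_generated :: "'a lgroup \<Rightarrow> 'a set \<Rightarrow> 'a set" where
  "l_ideal_generated G X = \<Inter> {H. l_ideal H G \<and> X \<subseteq> H}"

definition Cs_c :: "'a lgroup \<Rightarrow> 'a set gorder" where
  "Cs_c G =
    \<lparr>carrier = {convex_l_subgroup_generated G X |X. finite X \<and> X \<subseteq> carrier G},
     eq = (=), le = (\<subseteq>)\<rparr>"

definition Id_c :: "'a lgroup \<Rightarrow> 'a set gorder" where
  "Id_c G =
    \<lparr>carrier = {l_ideal_generated G X |X. finite X \<and> X \<subseteq> carrier G},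
     eq = (=), le = (\<subseteq>)\<rparr>"

text \<open>
  The lattice in the main result is sought with its carrier inside \<^typ>\<open>nat set set\<close>, which has
  at least aleph-two elements, so that every lattice of that cardinality has a copy there.
  HOL cannot quantify over the type carrying an l-group inside an existential statement, and
  \<open>\<exists>B. P B \<and> (\<forall>G :: 'g lgroup. Q B G)\<close> would let \<open>B\<close> depend on \<open>'g\<close>. The form
  \<open>(\<exists>B. P B) \<and> (\<forall>B. P B \<longrightarrow> (\<forall>G :: 'g lgroup. Q B G))\<close>, with \<open>'g\<close> not occurring in
  \<open>P\<close>, yields one \<open>B\<close> that works for all l-groups of all types.
\<close>

end

(*
  The lattice is a condensate of a cube of growth lattices, that is, of lattices of positive
  functions taken modulo f <= N * g, which are the lattices of principal l-ideals of Abelian l-groups.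

  Over the three edges 12, 23, 13 of the cube sit the lattices generated by the coordinate pairs
  (a, b), (b, c) and (a', c), all inside the growth lattice of the triples (a, b, c) with a choice
  of a' = a or a' = 4 * a.  Since a and a' have the same growth, the cube commutes, although it does
  not come from a commutative cube of l-groups.  A Cevian operation would compare 1, 2 and 3
  transitively at every point, the comparison of i and j depending only on the ratio of the
  coordinates of the edge ij.  The comparison of 1 and 2 changes sign between two successive powers
  of 2, and so does that of 2 and 3.  The factor 4 allows points on either side of both changes to
  have the same ratio a' : c, where the comparison of 1 and 3 would have to be both < and >=.

  The condensate consists of the sections, over all partial maps from {1, 2, 3} to aleph-two, that
  depend only on finitely many values in aleph-two.  A Cevian operation on it would, on a triple that is
  free for its supports, induce a Cevian choice on the cube.  Differences are countably based
  because the edge lattices are countable and closed under (f - N * g)^+.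

  The lattice of principal convex l-subgroups is Cevian by x, y |-> (x y^-1)^+.
*)
theory Submission
  imports Defs "HOL-Library.Extended_Nat"
begin

unbundle cardinal_syntax
notation Lattices.sup (infixl \<open>\<triangledown>\<close> 65)
  and Lattices.inf (infixl \<open>\<triangle>\<close> 70)

section \<open>Sublattices as carrier-based lattices\<close>

text \<open>The order is pulled back along \<open>inv_into A k\<close>, so any type with enough
  elements can host the lattice. This moves the sections of the condensate into
  \<open>nat set set\<close>.\<close>

definition copied_order :: "('a::order \<Rightarrow> 'b) \<Rightarrow> 'a set \<Rightarrow> 'b gorder" where
  "copied_order k A =
    \<lparr>carrier = k ` A, eq = (=), le = (\<lambda>X Y. inv_into A k X \<le> inv_into A k Y)\<rparr>"

locale copied_sublattice =
  fixes A :: "'a::{distrib_lattice,bounded_lattice} set" and k :: "'a \<Rightarrow> 'b"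
  assumes inj: "inj_on k A"
    and sup_closed: "\<And>x y. x \<in> A \<Longrightarrow> y \<in> A \<Longrightarrow> x \<triangledown> y \<in> A"
    and inf_closed: "\<And>x y. x \<in> A \<Longrightarrow> y \<in> A \<Longrightarrow> x \<triangle> y \<in> A"
    and bot_closed: "Orderings.bot \<in> A"
    and top_closed: "Orderings.top \<in> A"
begin

abbreviation "B \<equiv> copied_order k A"

lemma carrier_B: "carrier B = k ` A"
  by (simp add: copied_order_def)

lemma eq_B: "eq B = (=)"
  by (simp add: copied_order_def)

lemma le_B: "x \<in> A \<Longrightarrow> y \<in> A \<Longrightarrow> k x \<sqsubseteq>\<^bsub>B\<^esub> k y \<longleftrightarrow> x \<le> y"
  by (simp add: copied_order_def inj inv_into_f_f)

lemma partial_order_B: "partial_order B"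
proof unfold_locales
qed (auto simp: carrier_B le_B eq_B)

lemma least_sup: "x \<in> A \<Longrightarrow> y \<in> A \<Longrightarrow> least B (k (x \<triangledown> y)) (Upper B {k x, k y})"
  by (auto simp: least_def Upper_def carrier_B le_B sup_closed)

lemma greatest_inf: "x \<in> A \<Longrightarrow> y \<in> A \<Longrightarrow> greatest B (k (x \<triangle> y)) (Lower B {k x, k y})"
  by (auto simp: greatest_def Lower_def carrier_B le_B inf_closed)

lemma lattice_B: "lattice B"
proof -
  interpret partial_order B by (rule partial_order_B)
  show ?thesis
    by unfold_locales (auto simp: carrier_B intro: least_sup greatest_inf)
qed

lemma join_B: "x \<in> A \<Longrightarrow> y \<in> A \<Longrightarrow> k x \<squnion>\<^bsub>B\<^esub> k y = k (x \<triangledown> y)"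
proof -
  interpret Lattice.lattice B by (rule lattice_B)
  assume "x \<in> A" "y \<in> A"
  then show ?thesis
    using least_sup[of x y] by (metis carrier_B imageI join_def
        least_unique sup_of_two_least)
qed

lemma meet_B: "x \<in> A \<Longrightarrow> y \<in> A \<Longrightarrow> k x \<sqinter>\<^bsub>B\<^esub> k y = k (x \<triangle> y)"
proof -
  interpret Lattice.lattice B by (rule lattice_B)
  assume "x \<in> A" "y \<in> A"
  then show ?thesis
    using greatest_inf[of x y] by (metis carrier_B imageI meet_def
        greatest_unique inf_of_two_greatest)
qed

lemma bounded_lattice_B: "bounded_lattice B"
proof -
  interpret Lattice.lattice B by (rule lattice_B)
  show ?thesis
  proof unfold_locales
    show "\<exists>x. least B x (carrier B)"
      by (rule exI[of _ "k Orderings.bot"]) (auto simp: least_def carrier_B le_B bot_closed)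
    show "\<exists>x. greatest B x (carrier B)"
      by (rule exI[of _ "k Orderings.top"]) (auto simp: greatest_def carrier_B le_B top_closed)
  qed
qed

lemma bottom_B: "\<bottom>\<^bsub>B\<^esub> = k Orderings.bot"
proof -
  interpret bounded_lattice B by (rule bounded_lattice_B)
  show ?thesis
    by (rule bottom_eq[symmetric]) (auto simp: carrier_B le_B bot_closed)
qed

lemma distributive_B: "distributive_lattice_zero B"
proof -
  interpret bounded_lattice B by (rule bounded_lattice_B)
  show ?thesis
    by unfold_locales
      (auto simp: carrier_B join_B meet_B sup_closed inf_closed inf_sup_distrib1)
qed

lemma completely_normal_B:
  assumes "\<And>x y. x \<in> A \<Longrightarrow> y \<in> A \<Longrightarrow>
    \<exists>u\<in>A. \<exists>v\<in>A. x \<le> y \<triangledown> u \<and> y \<le> x \<triangledown> v \<and> u \<triangle> v = Orderings.bot"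
  shows "completely_normal B"
  unfolding completely_normal_def
  using assms distributive_B
  by (simp add: carrier_B join_B meet_B bottom_B le_B sup_closed) metis

lemma countably_based_differences_B:
  assumes "\<And>a b. a \<in> A \<Longrightarrow> b \<in> A \<Longrightarrow>
    \<exists>Y. countable Y \<and> Y \<subseteq> {x \<in> A. a \<le> b \<triangledown> x} \<and> (\<forall>x\<in>A. a \<le> b \<triangledown> x \<longrightarrow> (\<exists>y\<in>Y. y \<le> x))"
  shows "countably_based_differences B"
  unfolding countably_based_differences_def carrier_B
proof (intro ballI)
  fix a' b' assume "a' \<in> k ` A" "b' \<in> k ` A"
  then obtain a b where ab: "a \<in> A" "b \<in> A" "a' = k a" "b' = k b" by auto
  then obtain Y where Y: "countable Y" "Y \<subseteq> {x \<in> A. a \<le> b \<triangledown> x}"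
      "\<forall>x\<in>A. a \<le> b \<triangledown> x \<longrightarrow> (\<exists>y\<in>Y. y \<le> x)" using assms by meson
  have "coinitial B {x \<in> k ` A. a' \<sqsubseteq>\<^bsub>B\<^esub> b' \<squnion>\<^bsub>B\<^esub> x} (k ` Y)"
    unfolding coinitial_def
  proof (intro conjI ballI)
    show "k ` Y \<subseteq> {x \<in> k ` A. a' \<sqsubseteq>\<^bsub>B\<^esub> b' \<squnion>\<^bsub>B\<^esub> x}"
      using Y(2) ab by (auto simp: join_B le_B sup_closed)
    fix q assume "q \<in> {x \<in> k ` A. a' \<sqsubseteq>\<^bsub>B\<^esub> b' \<squnion>\<^bsub>B\<^esub> x}"
    then obtain x where x: "x \<in> A" "q = k x" "a \<le> b \<triangledown> x"
      using ab by (auto simp: join_B le_B sup_closed)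
    then obtain y where "y \<in> Y" "y \<le> x" using Y(3) by blast
    then show "\<exists>y\<in>k ` Y. y \<sqsubseteq>\<^bsub>B\<^esub> q" using x Y(2) le_B by auto
  qed
  then show "\<exists>Y. countable Y \<and> coinitial B {x \<in> k ` A. a' \<sqsubseteq>\<^bsub>B\<^esub> b' \<squnion>\<^bsub>B\<^esub> x} Y"
    using Y(1) by blast
qed

lemma cevian_B:
  assumes "cevian B"
  obtains d where "\<And>x y. x \<in> A \<Longrightarrow> y \<in> A \<Longrightarrow> d x y \<in> A"
    "\<And>x y. x \<in> A \<Longrightarrow> y \<in> A \<Longrightarrow> x \<le> y \<triangledown> d x y"
    "\<And>x y. x \<in> A \<Longrightarrow> y \<in> A \<Longrightarrow> d x y \<triangle> d y x = Orderings.bot"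
    "\<And>x y z. x \<in> A \<Longrightarrow> y \<in> A \<Longrightarrow> z \<in> A \<Longrightarrow> d x z \<le> d x y \<triangledown> d y z"
proof -
  obtain e where e: "cevian_operation B e" using assms unfolding cevian_def by blast
  define d where "d x y = inv_into A k (e (k x) (k y))" for x y
  have mem: "d x y \<in> A" and ke: "e (k x) (k y) = k (d x y)" if "x \<in> A" "y \<in> A" for x y
    using e that unfolding d_def cevian_operation_def carrier_B
    by (auto simp: inv_into_into f_inv_into_f)
  have kbot: "k x = k Orderings.bot \<Longrightarrow> x = Orderings.bot" if "x \<in> A" for x
    using inj that bot_closed by (auto dest: inj_onD)
  show thesis
  proof (rule that[of d])
    show "d x y \<in> A" if "x \<in> A" "y \<in> A" for x y using mem that .
    show "x \<le> y \<triangledown> d x y" if "x \<in> A" "y \<in> A" for x y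
      using e that unfolding cevian_operation_def carrier_B
      by (auto simp: ke mem join_B le_B sup_closed)
    show "d x y \<triangle> d y x = Orderings.bot" if "x \<in> A" "y \<in> A" for x y
      using e that unfolding cevian_operation_def carrier_B
      by (auto simp: ke mem meet_B bottom_B inf_closed intro!: kbot)
    show "d x z \<le> d x y \<triangledown> d y z" if "x \<in> A" "y \<in> A" "z \<in> A" for x y z
      using e that unfolding cevian_operation_def carrier_B
      by (auto simp: ke mem join_B le_B sup_closed)
  qed
qed

end

section \<open>Free triples\<close>

lemma card_of_le_nat_iff_countable: "|A| \<le>o natLeq \<longleftrightarrow> countable A"
proof -
  have "|A| \<le>o natLeq \<longleftrightarrow> |A| \<le>o |UNIV :: nat set|"
    using card_of_nat ordIso_symmetric ordLeq_ordIso_trans by blast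
  then show ?thesis
    unfolding card_of_ordLeq[symmetric] countable_def by auto
qed

text \<open>A case of Kuratowski's free set theorem. Take B of size aleph-one in W and A countably
  infinite in B; choose \<gamma> against all pairs from A and B, then \<beta> in B against all of A,
  and last \<alpha> in A against one finite set.\<close>

lemma free_triple:
  fixes F12 F13 F23 :: "'i \<Rightarrow> 'i \<Rightarrow> 'i set"
  assumes W: "cardSuc (cardSuc natLeq) \<le>o |W|"
    and fin: "\<And>\<alpha> \<beta>. finite (F12 \<alpha> \<beta>)" "\<And>\<alpha> \<beta>. finite (F13 \<alpha> \<beta>)" "\<And>\<alpha> \<beta>. finite (F23 \<alpha> \<beta>)"
  obtains \<alpha> \<beta> \<gamma> where "\<alpha> \<in> W" "\<beta> \<in> W" "\<gamma> \<in> W"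
    "\<gamma> \<notin> F12 \<alpha> \<beta>" "\<beta> \<notin> F13 \<alpha> \<gamma>" "\<alpha> \<notin> F23 \<beta> \<gamma>"
proof -
  let ?w1 = "cardSuc natLeq"
  have co: "Card_order ?w1" "Card_order (cardSuc ?w1)"
    by (simp_all add: cardSuc_Card_order natLeq_Card_order)
  have lt01: "natLeq <o ?w1" and lt12: "?w1 <o cardSuc ?w1"
    using co by (simp_all add: cardSuc_greater natLeq_Card_order)
  have "?w1 \<le>o |W|"
    by (rule ordLess_imp_ordLeq[OF ordLess_ordLeq_trans[OF lt12 W]])
  then have "|Field ?w1| \<le>o |W|"
    by (rule ordIso_ordLeq_trans[OF card_of_Field_ordIso[OF co(1)]])
  then obtain f where f: "inj_on f (Field ?w1)" "f ` Field ?w1 \<subseteq> W"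
    using card_of_ordLeq by metis
  define B where "B = f ` Field ?w1"
  have "|Field ?w1| =o |B|"
    by (rule card_of_ordIsoI[of f]) (simp add: bij_betw_def f B_def)
  then have B: "|B| =o ?w1"
    by (rule ordIso_transitive[OF ordIso_symmetric card_of_Field_ordIso[OF co(1)]])
  then have ltB: "natLeq <o |B|"
    by (rule ordLess_ordIso_trans[OF lt01 ordIso_symmetric])
  have BW: "B \<subseteq> W" using f(2) B_def by blast
  have uncB: "\<not> countable B"
    unfolding card_of_le_nat_iff_countable[symmetric] by (rule not_ordLess_ordLeq[OF ltB])
  then have infB: "infinite B" using countable_finite by blast
  then obtain A where A: "A \<subseteq> B" "infinite A" "countable A"
    using infinite_countable_subset'[of B] by auto
  have small: "|X| \<le>o |B|" if "countable X" for X
    using that unfolding card_of_le_nat_iff_countable[symmetric]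
    by (rule ordLeq_transitive[OF _ ordLess_imp_ordLeq[OF ltB]])
  \<comment> \<open>At most aleph-one finite sets are united, too few to cover
    \<open>W\<close>.\<close>
  have "|\<Union>\<alpha>\<in>A. \<Union>\<beta>\<in>B. F12 \<alpha> \<beta>| \<le>o |B|"
    by (intro card_of_UNION_ordLeq_infinite infB ballI small countable_finite fin card_of_mono1 A(1))
      simp
  moreover have "\<not> |W| \<le>o |B|"
    by (rule not_ordLess_ordLeq[OF ordIso_ordLess_trans[OF B ordLess_ordLeq_trans[OF lt12 W]]])
  ultimately have "\<not> W \<subseteq> (\<Union>\<alpha>\<in>A. \<Union>\<beta>\<in>B. F12 \<alpha> \<beta>)"
    using ordLeq_transitive[OF card_of_mono1] by blast
  then obtain \<gamma> where \<gamma>: "\<gamma> \<in> W" "\<And>\<alpha> \<beta>. \<alpha> \<in> A \<Longrightarrow> \<beta> \<in> B \<Longrightarrow> \<gamma> \<notin> F12 \<alpha> \<beta>" by blast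
  have "countable (\<Union>\<alpha>\<in>A. F13 \<alpha> \<gamma>)" using A(3) fin by (intro countable_UN) (auto intro: countable_finite)
  then have "\<not> B \<subseteq> (\<Union>\<alpha>\<in>A. F13 \<alpha> \<gamma>)" using uncB countable_subset by metis
  then obtain \<beta> where \<beta>: "\<beta> \<in> B" "\<And>\<alpha>. \<alpha> \<in> A \<Longrightarrow> \<beta> \<notin> F13 \<alpha> \<gamma>"
    by blast
  have "\<not> A \<subseteq> F23 \<beta> \<gamma>" using A(2) fin(3) finite_subset by metis
  then obtain \<alpha> where \<alpha>: "\<alpha> \<in> A" "\<alpha> \<notin> F23 \<beta> \<gamma>" by blast
  show thesis
    using that[of \<alpha> \<beta> \<gamma>] \<alpha> \<beta> \<gamma> A(1) BW by blast
qed

lemma card_of_finite_subsets: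
  assumes "infinite W"
  shows "|{F. finite F \<and> F \<subseteq> W}| \<le>o |W|"
proof -
  let ?P = "\<lambda>n. {F. finite F \<and> card F = n \<and> F \<subseteq> W}"
  have "|?P n| \<le>o |W|" for n
  proof (induction n)
    case 0
    have "?P 0 = {{}}" by auto
    then show ?case
      using assms card_of_singl_ordLeq[of W "{}"] by (metis finite.emptyI)
  next
    case (Suc n)
    have "?P (Suc n) \<subseteq> (\<lambda>(x, F). insert x F) ` (W \<times> ?P n)"
    proof
      fix F assume "F \<in> ?P (Suc n)"
      then obtain x G where "F = insert x G" "x \<notin> G" "card G = n" "finite G" "F \<subseteq> W"
        by (auto simp: card_Suc_eq)
      then show "F \<in> (\<lambda>(x, F). insert x F) ` (W \<times> ?P n)" by auto
    qed
    then have "|?P (Suc n)| \<le>o |W \<times> ?P n|"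
      by (rule ordLeq_transitive[OF card_of_mono1 card_of_image])
    also have "|W \<times> ?P n| \<le>o |W \<times> W|"
      using Suc card_of_Times_mono2 by blast
    also have "|W \<times> W| =o |W|" using assms card_of_Times_same_infinite by blast
    finally show ?case .
  qed
  then have "|\<Union>n. ?P n| \<le>o |W|"
    using assms infinite_iff_card_of_nat by (intro card_of_UNION_ordLeq_infinite) auto
  moreover have "{F. finite F \<and> F \<subseteq> W} = (\<Union>n. ?P n)" by auto
  ultimately show ?thesis by simp
qed

section \<open>Condensates\<close>

text \<open>A retraction onto the partial maps with values in \<open>F\<close>. Sections supported
  in \<open>F\<close> do not distinguish points with the same image, and on finitely many
  coordinates a finite \<open>F\<close> leaves only finitely many images.\<close>

definition restr :: "'i set \<Rightarrow> ('j \<rightharpoonup> 'i) \<Rightarrow> ('j \<rightharpoonup> 'i)" where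
  "restr F q = (\<lambda>j. case q j of None \<Rightarrow> None | Some \<alpha> \<Rightarrow> if \<alpha> \<in> F then Some \<alpha> else None)"

lemma restr_restr: "restr F (restr G q) = restr (F \<inter> G) q"
  by (auto simp: restr_def split: option.splits)

lemma dom_restr: "dom (restr F q) \<subseteq> dom q"
  by (auto simp: restr_def split: option.splits)

lemma restr_eqI: "(\<And>j \<alpha>. \<alpha> \<in> F \<Longrightarrow> q j = Some \<alpha> \<longleftrightarrow> r j = Some \<alpha>) \<Longrightarrow> restr F q = restr F r"
proof (rule ext)
  fix j assume "\<And>j \<alpha>. \<alpha> \<in> F \<Longrightarrow> q j = Some \<alpha> \<longleftrightarrow> r j = Some \<alpha>"
  then have "\<forall>\<alpha>\<in>F. q j = Some \<alpha> \<longleftrightarrow> r j = Some \<alpha>" by blast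
  then show "restr F q j = restr F r j"
    by (cases "q j"; cases "r j") (auto simp: restr_def)
qed

lemma finite_range_restr:
  assumes "finite F"
  shows "finite (range (restr F :: ('j::finite \<rightharpoonup> 'i) \<Rightarrow> _))"
proof -
  have "range (restr F :: ('j \<rightharpoonup> 'i) \<Rightarrow> _) \<subseteq> {q. \<forall>j. (j \<in> UNIV \<longrightarrow> q j \<in> insert None (Some ` F)) \<and> (j \<notin> UNIV \<longrightarrow> q j = None)}"
    by (auto simp: restr_def split: option.splits)
  then show ?thesis
    by (rule finite_subset) (rule finite_set_of_finite_funs, use assms in auto)
qed

text \<open>The substantial assumption is \<open>difference_D\<close>: a solution in the larger
  stalk lies above one in the smaller countable stalk, so enlarging the stalk does not destroy a
  coinitial set.\<close>

locale stalks =
  fixes D :: "'j::finite set \<Rightarrow> 'l::{distrib_lattice,bounded_lattice} set"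
  assumes sup_D: "x \<in> D S \<Longrightarrow> y \<in> D S \<Longrightarrow> x \<triangledown> y \<in> D S"
    and inf_D: "x \<in> D S \<Longrightarrow> y \<in> D S \<Longrightarrow> x \<triangle> y \<in> D S"
    and bot_D: "Orderings.bot \<in> D S"
    and top_D: "Orderings.top \<in> D S"
    and mono_D: "S \<subseteq> T \<Longrightarrow> D S \<subseteq> D T"
    and countable_D: "countable (D S)"
    and normal_D: "x \<in> D S \<Longrightarrow> y \<in> D S \<Longrightarrow>
      \<exists>u\<in>D S. \<exists>v\<in>D S. x \<le> y \<triangledown> u \<and> y \<le> x \<triangledown> v \<and> u \<triangle> v = Orderings.bot"
    and difference_D: "a \<in> D S \<Longrightarrow> b \<in> D S \<Longrightarrow> y \<in> D T \<Longrightarrow> S \<subseteq> T \<Longrightarrow> a \<le> b \<triangledown> y \<Longrightarrow>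
      \<exists>x\<in>D S. a \<le> b \<triangledown> x \<and> x \<le> y"
begin

definition supported :: "'i set \<Rightarrow> (('j \<rightharpoonup> 'i) \<Rightarrow> 'l) \<Rightarrow> bool" where
  "supported F s \<longleftrightarrow> (\<forall>q. s q \<in> D (dom q)) \<and> (\<forall>q. s (restr F q) = s q)"

text \<open>
  Partial maps are the points of a power of the one-point compactification of the discrete
  space of indices, with \<^const>\<open>None\<close> at infinity. Finite support means that a section is
  locally constant, its value at nearby points of larger domain being the same element of a
  larger stalk.
\<close>

definition sections :: "'i set \<Rightarrow> (('j \<rightharpoonup> 'i) \<Rightarrow> 'l) set" where
  "sections W = {s. \<exists>F. finite F \<and> F \<subseteq> W \<and> supported F s}"

lemma supported_mono:
  assumes "supported F s" "F \<subseteq> G"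
  shows "supported G s"
proof -
  have "s (restr G q) = s q" for q
    using assms by (metis supported_def restr_restr inf.absorb1)
  then show ?thesis using assms(1) by (simp add: supported_def)
qed

text \<open>Composing with \<open>restr F\<close> makes any pointwise choice supported in
  \<open>F\<close>. It stays in the right stalks because restricting a point only shrinks its
  domain.\<close>

lemma supported_extend:
  assumes "\<And>q. t q \<in> D (dom q)"
  shows "supported F (\<lambda>q. t (restr F q))"
  using assms mono_D[OF dom_restr] by (auto simp: supported_def restr_restr)

lemma sectionsE2:
  assumes "s \<in> sections W" "t \<in> sections W"
  obtains F where "finite F" "F \<subseteq> W" "supported F s" "supported F t"
proof -
  obtain F G where "finite F" "F \<subseteq> W" "supported F s" "finite G" "G \<subseteq> W" "supported G t"
    using assms by (auto simp: sections_def)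
  then show thesis
    using that[of "F \<union> G"] supported_mono by (metis Un_least finite_UnI sup.cobounded1 sup.cobounded2)
qed

lemma sup_sections: "s \<in> sections W \<Longrightarrow> t \<in> sections W \<Longrightarrow> s \<triangledown> t \<in> sections W"
  by (erule (1) sectionsE2) (auto simp: sections_def supported_def sup_D)

lemma inf_sections: "s \<in> sections W \<Longrightarrow> t \<in> sections W \<Longrightarrow> s \<triangle> t \<in> sections W"
  by (erule (1) sectionsE2) (auto simp: sections_def supported_def inf_D)

lemma bot_sections: "Orderings.bot \<in> sections W"
  by (auto simp: sections_def supported_def bot_D intro: exI[of _ "{}"])

lemma top_sections: "Orderings.top \<in> sections W"
  by (auto simp: sections_def supported_def top_D intro: exI[of _ "{}"])

text \<open>Witnesses chosen point by point need not have finite support. Reading them at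
  \<open>restr F q\<close> repairs this and keeps the inequalities, since s and t do not change
  under the restriction.\<close>

lemma normal_sections:
  assumes "s \<in> sections W" "t \<in> sections W"
  shows "\<exists>u\<in>sections W. \<exists>v\<in>sections W. s \<le> t \<triangledown> u \<and> t \<le> s \<triangledown> v \<and> u \<triangle> v = Orderings.bot"
proof -
  obtain F where F: "finite F" "F \<subseteq> W" "supported F s" "supported F t"
    using sectionsE2 assms .
  have "\<forall>q. \<exists>u v. u \<in> D (dom q) \<and> v \<in> D (dom q) \<and> s q \<le> t q \<triangledown> u \<and> t q \<le> s q \<triangledown> v \<and>
      u \<triangle> v = Orderings.bot"
    using F normal_D unfolding supported_def by metis
  then obtain u v where uv: "\<And>q. u q \<in> D (dom q)" "\<And>q. v q \<in> D (dom q)" "\<And>q. s q \<le> t q \<triangledown> u q"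
      "\<And>q. t q \<le> s q \<triangledown> v q" "\<And>q. u q \<triangle> v q = Orderings.bot"
    by metis
  let ?u = "\<lambda>q. u (restr F q)" and ?v = "\<lambda>q. v (restr F q)"
  have "?u \<in> sections W" "?v \<in> sections W"
    using F supported_extend uv(1,2) unfolding sections_def by blast+
  moreover have "s \<le> t \<triangledown> ?u" "t \<le> s \<triangledown> ?v"
    using F uv(3,4) unfolding le_fun_def sup_fun_def supported_def by metis+
  moreover have "?u \<triangle> ?v = Orderings.bot" using uv(5) by (auto simp: fun_eq_iff)
  ultimately show ?thesis by blast
qed

text \<open>Such a section is determined by its values at the finitely many restricted points, and
  these come from countably many stalk elements.\<close>

lemma countable_supported:
  fixes F :: "'i set"
  assumes "finite F"
  shows "countable {s. supported F s}"
proof -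
  obtain rs where rs: "set rs = range (restr F :: ('j \<rightharpoonup> 'i) \<Rightarrow> _)"
    using finite_list[OF finite_range_restr[OF assms]] by metis
  have "countable (lists (\<Union>S. D S))" by (simp add: countable_D)
  moreover have "(\<lambda>s. map s rs) ` {s. supported F s} \<subseteq> lists (\<Union>S. D S)"
    by (fastforce simp: supported_def)
  moreover have "inj_on (\<lambda>s. map s rs) {s. supported F s}"
  proof (rule inj_onI, rule ext)
    fix s t q assume st: "s \<in> {s. supported F s}" "t \<in> {s. supported F s}" "map s rs = map t rs"
    then have "s (restr F q) = t (restr F q)" using rs by auto
    then show "s q = t q" using st by (simp add: supported_def)
  qed
  ultimately show ?thesis
    by (metis countable_image_inj_on countable_subset)
qed

text \<open>Solve below each y separately and take the meet, over which joins with b distribute. The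
  empty family is solved by top.\<close>

lemma difference_finite:
  assumes "a \<in> D S" "b \<in> D S" "finite V" "\<And>y. y \<in> V \<Longrightarrow> a \<le> b \<triangledown> y \<and> (\<exists>T. S \<subseteq> T \<and> y \<in> D T)"
  shows "\<exists>x\<in>D S. a \<le> b \<triangledown> x \<and> (\<forall>y\<in>V. x \<le> y)"
  using assms(3,4)
proof (induction V)
  case empty
  show ?case using top_D by (intro bexI[of _ Orderings.top]) auto
next
  case (insert y V)
  then obtain x where x: "x \<in> D S" "a \<le> b \<triangledown> x" "\<forall>y\<in>V. x \<le> y" by auto
  obtain x' where x': "x' \<in> D S" "a \<le> b \<triangledown> x'" "x' \<le> y"
    using difference_D[OF assms(1,2)] insert.prems by (metis insertI1)
  show ?case
  proof (intro bexI conjI)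
    show "x \<triangle> x' \<in> D S" using x x' inf_D by blast
    show "a \<le> b \<triangledown> x \<triangle> x'" using x x' by (simp add: sup_inf_distrib1)
    show "\<forall>z\<in>insert y V. x \<triangle> x' \<le> z" using x x' by (auto intro: le_infI1 le_infI2)
  qed
qed

text \<open>The solutions supported in a common support \<open>F\<close> of s and t form the
  countable coinitial set. Below a solution x of larger support lies one of these: at each p take a
  solution below all values of x at points that restrict to p.\<close>

lemma countably_based_sections:
  assumes "s \<in> sections W" "t \<in> sections W"
  shows "\<exists>Y. countable Y \<and> Y \<subseteq> {x \<in> sections W. s \<le> t \<triangledown> x} \<and>
    (\<forall>x\<in>sections W. s \<le> t \<triangledown> x \<longrightarrow> (\<exists>y\<in>Y. y \<le> x))"
proof -
  obtain F where F: "finite F" "F \<subseteq> W" "supported F s" "supported F t"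
    using sectionsE2 assms .
  have "\<exists>y. supported F y \<and> s \<le> t \<triangledown> y \<and> y \<le> x" if x: "x \<in> sections W" "s \<le> t \<triangledown> x" for x
  proof -
    obtain G where G: "finite G" "supported G x" using x(1) by (auto simp: sections_def)
    \<comment> \<open>Finite support of x leaves only finitely many values over each p, so that
      their lower bound can be formed by finite meets.\<close>
    have fin: "finite (range x)"
    proof -
      have "range x \<subseteq> x ` range (restr G)"
        using G(2) unfolding supported_def by (metis image_subsetI rangeI image_eqI)
      then show ?thesis using finite_range_restr[OF G(1)] finite_surj by blast
    qed
    have "\<exists>z\<in>D (dom p). s p \<le> t p \<triangledown> z \<and> (\<forall>y \<in> {x q |q. restr F q = p}. z \<le> y)" for p
    proof (rule difference_finite)
      show "s p \<in> D (dom p)" "t p \<in> D (dom p)" using F by (auto simp: supported_def)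
      show "finite {x q |q. restr F q = p}" by (rule finite_subset[OF _ fin]) auto
      fix y assume "y \<in> {x q |q. restr F q = p}"
      then obtain q where q: "y = x q" "restr F q = p" by blast
      have "s p \<le> t p \<triangledown> y"
        using F(3,4) q x(2) unfolding supported_def le_fun_def sup_fun_def by metis
      then show "s p \<le> t p \<triangledown> y \<and> (\<exists>T. dom p \<subseteq> T \<and> y \<in> D T)"
        using q G(2) dom_restr[of F q] unfolding supported_def by blast
    qed
    then obtain z where z: "\<And>p. z p \<in> D (dom p)" "\<And>p. s p \<le> t p \<triangledown> z p"
        "\<And>p q. restr F q = p \<Longrightarrow> z p \<le> x q" by (simp add: Bex_def) metis
    have "supported F (\<lambda>q. z (restr F q))" using supported_extend z(1) .
    moreover have "s \<le> t \<triangledown> (\<lambda>q. z (restr F q))"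
      using z(2) F(3,4) unfolding supported_def le_fun_def sup_fun_def by metis
    ultimately show ?thesis using z(3) by (auto simp: le_fun_def)
  qed
  moreover have "countable {y. supported F y \<and> s \<le> t \<triangledown> y}"
    using countable_supported[OF F(1)] by (rule countable_subset[rotated]) auto
  ultimately show ?thesis
    using F(1,2) by (intro exI[of _ "{y. supported F y \<and> s \<le> t \<triangledown> y}"]) (auto simp: sections_def)
qed

lemma card_of_sections_le:
  assumes "infinite W"
  shows "|sections W| \<le>o |W|"
proof -
  have "sections W = (\<Union>F\<in>{F. finite F \<and> F \<subseteq> W}. {s. supported F s})"
    by (auto simp: sections_def)
  moreover have "|\<Union>F\<in>{F. finite F \<and> F \<subseteq> W}. {s. supported F s}| \<le>o |W|"
  proof (intro card_of_UNION_ordLeq_infinite assms ballI)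
    show "|{F. finite F \<and> F \<subseteq> W}| \<le>o |W|" using card_of_finite_subsets assms .
    show "|{s. supported F s}| \<le>o |W|" if "F \<in> {F. finite F \<and> F \<subseteq> W}" for F
    proof -
      have "|{s. supported F s}| \<le>o natLeq"
        unfolding card_of_le_nat_iff_countable using countable_supported that by blast
      then show ?thesis
        using assms infinite_iff_natLeq_ordLeq ordLeq_transitive by blast
    qed
  qed
  ultimately show ?thesis by simp
qed

text \<open>Test sections: each carries a vertex element at a single index \<alpha>, so that a
  Cevian operation applied to two of them can be read as a comparison of two vertices.\<close>

definition spot :: "('j \<Rightarrow> 'l) \<Rightarrow> 'j \<Rightarrow> 'i \<Rightarrow> ('j \<rightharpoonup> 'i) \<Rightarrow> 'l" where
  "spot a j \<alpha> = (\<lambda>q. if q j = Some \<alpha> then a j else Orderings.bot)"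

lemma spot_sections:
  assumes "a j \<in> D {j}" "\<alpha> \<in> W"
  shows "spot a j \<alpha> \<in> sections W"
proof -
  have "a j \<in> D T" if "j \<in> T" for T using assms(1) mono_D[of "{j}" T] that by blast
  then have "supported {\<alpha>} (spot a j \<alpha>)"
    by (auto simp: supported_def spot_def restr_def bot_D domI split: option.splits if_splits)
  then show ?thesis using assms(2) by (auto simp: sections_def)
qed

lemma card_of_sections_ge:
  fixes W :: "'i set"
  assumes "a j \<in> D {j}" "a j \<noteq> Orderings.bot"
  shows "|W| \<le>o |sections W|"
proof -
  have "inj_on (spot a j) W"
  proof (rule inj_onI)
    fix \<alpha> \<beta> :: 'i assume "spot a j \<alpha> = spot a j \<beta>"
    from fun_cong[OF this, of "[j \<mapsto> \<alpha>]"] show "\<alpha> = \<beta>"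
      using assms(2) by (auto simp: spot_def split: if_splits)
  qed
  moreover have "spot a j ` W \<subseteq> sections W" by (rule image_subsetI) (rule spot_sections[where a = a and j = j, OF assms(1)])
  ultimately show ?thesis using card_of_ordLeq[of W] by metis
qed

end

section \<open>Evaluating a Cevian operation at a free triple\<close>

datatype ix = I1 | I2 | I3

lemma UNIV_ix: "UNIV = {I1, I2, I3}"
  using ix.exhaust by auto

instance ix :: finite
  by standard (simp add: UNIV_ix)

text \<open>Apply the operation to the spots of a free triple and evaluate at the point
  \<open>q\<close> defined on all three vertices. Freeness keeps the third index out of the support
  of each difference of two spots, so its value at \<open>q\<close> already lies in the stalk of the
  edge. The values form a Cevian choice on the triangle, which \<open>no_choice\<close>
  excludes.\<close>

lemma no_cevian_sections:
  fixes D :: "ix set \<Rightarrow> 'l::{distrib_lattice,bounded_lattice} set" and W :: "'i set"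
  assumes "stalks D"
    and W: "cardSuc (cardSuc natLeq) \<le>o |W|"
    and a: "\<And>j. a j \<in> D {j}"
    and no_choice: "\<And>x. (\<And>i j. i \<noteq> j \<Longrightarrow> x i j \<in> D {i, j}) \<Longrightarrow>
      (\<And>i j. i \<noteq> j \<Longrightarrow> a i \<le> a j \<triangledown> x i j) \<Longrightarrow>
      (\<And>i j. i \<noteq> j \<Longrightarrow> x i j \<triangle> x j i = Orderings.bot) \<Longrightarrow>
      (\<And>i j k. x i k \<le> x i j \<triangledown> x j k) \<Longrightarrow> False"
    and d: "\<And>s t. s \<in> stalks.sections D W \<Longrightarrow> t \<in> stalks.sections D W \<Longrightarrow> d s t \<in> stalks.sections D W"
      "\<And>s t. s \<in> stalks.sections D W \<Longrightarrow> t \<in> stalks.sections D W \<Longrightarrow> s \<le> t \<triangledown> d s t"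
      "\<And>s t. s \<in> stalks.sections D W \<Longrightarrow> t \<in> stalks.sections D W \<Longrightarrow> d s t \<triangle> d t s = Orderings.bot"
      "\<And>s t u. s \<in> stalks.sections D W \<Longrightarrow> t \<in> stalks.sections D W \<Longrightarrow> u \<in> stalks.sections D W \<Longrightarrow>
        d s u \<le> d s t \<triangledown> d t u"
  shows False
proof -
  interpret stalks D by fact
  define x where "x i \<alpha> j \<beta> = d (spot a i \<alpha>) (spot a j \<beta>)" for i j and \<alpha> \<beta> :: 'i
  have spot: "spot a i \<alpha> \<in> sections W" if "\<alpha> \<in> W" for i \<alpha>
    using spot_sections[where a = a and j = i, OF a that] .
  have "\<forall>i \<alpha> j \<beta>. \<exists>F. finite F \<and> (\<alpha> \<in> W \<longrightarrow> \<beta> \<in> W \<longrightarrow> supported F (x i \<alpha> j \<beta>))"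
  proof (intro allI)
    fix i \<alpha> j \<beta>
    show "\<exists>F. finite F \<and> (\<alpha> \<in> W \<longrightarrow> \<beta> \<in> W \<longrightarrow> supported F (x i \<alpha> j \<beta>))"
      using d(1)[OF spot spot, of \<alpha> \<beta> i j] unfolding sections_def x_def by blast
  qed
  then obtain F where F: "\<And>i \<alpha> j \<beta>. finite (F i \<alpha> j \<beta>)"
      "\<And>i \<alpha> j \<beta>. \<alpha> \<in> W \<Longrightarrow> \<beta> \<in> W \<Longrightarrow> supported (F i \<alpha> j \<beta>) (x i \<alpha> j \<beta>)"
    by metis
  \<comment> \<open>Both orders of the arguments enter, so one freeness condition controls the
    differences in either direction.\<close>
  define G where "G i j \<alpha> \<beta> = F i \<alpha> j \<beta> \<union> F j \<beta> i \<alpha>" for i j \<alpha> \<beta>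
  have "finite (G i j \<alpha> \<beta>)" for i j \<alpha> \<beta> using F(1) by (simp add: G_def)
  then obtain \<alpha> \<beta> \<gamma> where free: "\<alpha> \<in> W" "\<beta> \<in> W" "\<gamma> \<in> W"
      "\<gamma> \<notin> G I1 I2 \<alpha> \<beta>" "\<beta> \<notin> G I1 I3 \<alpha> \<gamma>" "\<alpha> \<notin> G I2 I3 \<beta> \<gamma>"
    using free_triple[OF W, of "G I1 I2" "G I1 I3" "G I2 I3"] by blast
  define c where "c i = (case i of I1 \<Rightarrow> \<alpha> | I2 \<Rightarrow> \<beta> | I3 \<Rightarrow> \<gamma>)" for i
  have c: "c i \<in> W" for i using free(1-3) by (cases i) (auto simp: c_def)
  have avoid: "c k \<notin> F i (c i) j (c j)" if "k \<noteq> i" "k \<noteq> j" "i \<noteq> j" for i j k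
    using that free(4-6) by (cases i; cases j; cases k) (auto simp: c_def G_def)
  define q where "q i = Some (c i)" for i
  have spot_c: "spot a i (c i) \<in> sections W" for i using spot c by blast
  have at_q: "spot a i (c i) q = a i" for i by (simp add: spot_def q_def)
  show False
  proof (rule no_choice)
    fix i j :: ix assume ij: "i \<noteq> j"
    let ?r = "[i \<mapsto> c i, j \<mapsto> c j]" and ?F = "F i (c i) j (c j)"
    have sup: "supported ?F (x i (c i) j (c j))" using F(2) c by blast
    \<comment> \<open>Only the third vertex separates \<open>q\<close> from \<open>?r\<close>, and
      its index lies outside \<open>?F\<close>.\<close>
    have "restr ?F q = restr ?F ?r"
      using avoid ij by (intro restr_eqI) (auto simp: q_def)
    then have "x i (c i) j (c j) q = x i (c i) j (c j) ?r"
      using sup unfolding supported_def by metis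
    moreover have "dom ?r = {i, j}" by auto
    ultimately show "x i (c i) j (c j) q \<in> D {i, j}"
      using sup unfolding supported_def by metis
    show "a i \<le> a j \<triangledown> x i (c i) j (c j) q"
      using d(2)[OF spot_c spot_c, of i j, THEN le_funD, of q] by (simp add: at_q x_def)
    show "x i (c i) j (c j) q \<triangle> x j (c j) i (c i) q = Orderings.bot"
      using d(3)[OF spot_c spot_c, of i j, THEN fun_cong, of q] by (simp add: x_def)
  next
    fix i j k
    show "x i (c i) k (c k) q \<le> x i (c i) j (c j) q \<triangledown> x j (c j) k (c k) q"
      using d(4)[OF spot_c spot_c spot_c, of i k j, THEN le_funD, of q] by (simp add: x_def)
  qed
qed

section \<open>Growth classes\<close>

text \<open>Extended naturals let the constant infinity serve as a top element.\<close>

definition dominated :: "('e \<Rightarrow> enat) \<Rightarrow> ('e \<Rightarrow> enat) \<Rightarrow> bool" where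
  "dominated f g \<longleftrightarrow> (\<exists>N::nat. \<forall>e. f e \<le> enat N * g e)"

lemma dominatedI: "(\<And>e. f e \<le> enat N * g e) \<Longrightarrow> dominated f g"
  by (auto simp: dominated_def)

lemma dominated_le: "(\<And>e. f e \<le> g e) \<Longrightarrow> dominated f g"
  by (rule dominatedI[of _ 1]) (metis enat_1 mult_1)

lemma enat_mult_mono: "(a::enat) \<le> b \<Longrightarrow> c \<le> d \<Longrightarrow> a * c \<le> b * d"
  by (rule mult_mono) auto

lemma dominated_trans:
  assumes "dominated f g" "dominated g h"
  shows "dominated f h"
proof -
  obtain N M where N: "\<And>e. f e \<le> enat N * g e" and M: "\<And>e. g e \<le> enat M * h e"
    using assms unfolding dominated_def by blast
  have "f e \<le> enat (N * M) * h e" for e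
  proof -
    have "f e \<le> enat N * g e" by (rule N)
    also have "\<dots> \<le> enat N * (enat M * h e)" using M by (intro enat_mult_mono) auto
    finally show ?thesis by (simp add: mult.assoc[symmetric])
  qed
  then show ?thesis by (rule dominatedI)
qed

lemma dominated_max:
  assumes "dominated f h" "dominated g h"
  shows "dominated (\<lambda>e. max (f e) (g e)) h"
proof -
  obtain N M where N: "\<And>e. f e \<le> enat N * h e" and M: "\<And>e. g e \<le> enat M * h e"
    using assms unfolding dominated_def by blast
  have "max (f e) (g e) \<le> enat (N + M) * h e" for e
    using order_trans[OF N[of e] enat_mult_mono[of "enat N" "enat (N + M)"]]
      order_trans[OF M[of e] enat_mult_mono[of "enat M" "enat (N + M)"]] by simp
  then show ?thesis by (rule dominatedI)
qed

lemma dominated_min: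
  assumes "dominated h f" "dominated h g"
  shows "dominated h (\<lambda>e. min (f e) (g e))"
proof -
  obtain N M where N: "\<And>e. h e \<le> enat N * f e" and M: "\<And>e. h e \<le> enat M * g e"
    using assms unfolding dominated_def by blast
  have "h e \<le> enat (N + M) * min (f e) (g e)" for e
    using order_trans[OF N[of e] enat_mult_mono[of "enat N" "enat (N + M)"]]
      order_trans[OF M[of e] enat_mult_mono[of "enat M" "enat (N + M)"]] by (simp add: min_def)
  then show ?thesis by (rule dominatedI)
qed

lemma dominated_max_mono:
  assumes "dominated f f'" "dominated g g'"
  shows "dominated (\<lambda>e. max (f e) (g e)) (\<lambda>e. max (f' e) (g' e))"
  by (intro dominated_max assms[THEN dominated_trans] dominated_le) simp_all

lemma dominated_min_mono:
  assumes "dominated f f'" "dominated g g'"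
  shows "dominated (\<lambda>e. min (f e) (g e)) (\<lambda>e. min (f' e) (g' e))"
  by (intro dominated_min dominated_trans[OF _ assms(1)] dominated_trans[OF _ assms(2)]
      dominated_le) simp_all

lemma dominated_zero: "dominated f g \<Longrightarrow> g e = 0 \<Longrightarrow> f e = 0"
  unfolding dominated_def by (metis ile0_eq mult_zero_right)

quotient_type 'e growth = "'e \<Rightarrow> enat" / "\<lambda>f g. dominated f g \<and> dominated g f"
  by (rule equivpI) (auto intro!: reflpI sympI transpI intro: dominated_le dominated_trans)

instantiation growth :: (type) "{distrib_lattice, bounded_lattice}"
begin

lift_definition less_eq_growth :: "'a growth \<Rightarrow> 'a growth \<Rightarrow> bool" is dominated
  by (meson dominated_trans)

definition less_growth :: "'a growth \<Rightarrow> 'a growth \<Rightarrow> bool" where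
  "less_growth x y \<longleftrightarrow> x \<le> y \<and> \<not> y \<le> x"

lift_definition sup_growth :: "'a growth \<Rightarrow> 'a growth \<Rightarrow> 'a growth" is "\<lambda>f g e. max (f e) (g e)"
  by (simp add: dominated_max_mono)

lift_definition inf_growth :: "'a growth \<Rightarrow> 'a growth \<Rightarrow> 'a growth" is "\<lambda>f g e. min (f e) (g e)"
  by (simp add: dominated_min_mono)

lift_definition bot_growth :: "'a growth" is "\<lambda>_. 0" .

lift_definition top_growth :: "'a growth" is "\<lambda>_. \<infinity>" .

instance
proof
  fix x y z :: "'a growth"
  show "x < y \<longleftrightarrow> x \<le> y \<and> \<not> y \<le> x" by (simp add: less_growth_def)
  show "x \<le> x" by transfer (simp add: dominated_le)
  show "x \<le> y \<Longrightarrow> y \<le> z \<Longrightarrow> x \<le> z" by transfer (rule dominated_trans)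
  show "x \<le> y \<Longrightarrow> y \<le> x \<Longrightarrow> x = y" by transfer simp
  show "x \<triangle> y \<le> x" "x \<triangle> y \<le> y" by (transfer; simp add: dominated_le)+
  show "x \<le> y \<Longrightarrow> x \<le> z \<Longrightarrow> x \<le> y \<triangle> z" by transfer (rule dominated_min)
  show "x \<le> x \<triangledown> y" "y \<le> x \<triangledown> y" by (transfer; simp add: dominated_le)+
  show "y \<le> x \<Longrightarrow> z \<le> x \<Longrightarrow> y \<triangledown> z \<le> x" by transfer (rule dominated_max)
  show "Orderings.bot \<le> x" by transfer (simp add: dominated_le)
  show "x \<le> Orderings.top" by transfer (simp add: dominated_le)
  show "x \<triangledown> (y \<triangle> z) = (x \<triangledown> y) \<triangle> (x \<triangledown> z)"
    by transfer (simp add: max_min_distrib2 dominated_le)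
qed

end

text \<open>Domination preserves zeros, so the zero set depends only on the growth class. The
  resulting lattice homomorphism into sets of points turns the laws of a Cevian choice into
  conditions at single points.\<close>

lift_definition supp :: "'e growth \<Rightarrow> 'e set" is "\<lambda>f. {e. f e \<noteq> 0}"
  by (auto dest: dominated_zero)

lemma supp_sup: "supp (x \<triangledown> y) = supp x \<union> supp y"
  by transfer (auto simp: max_def)

lemma supp_inf: "supp (x \<triangle> y) = supp x \<inter> supp y"
  by transfer (auto simp: min_def)

lemma supp_mono: "x \<le> y \<Longrightarrow> supp x \<subseteq> supp y"
  by transfer (auto dest: dominated_zero)

lemma supp_bot: "supp Orderings.bot = {}"
  by transfer simp

lemma supp_top: "supp Orderings.top = UNIV"
  by transfer simp

lift_definition growth :: "('e \<Rightarrow> nat) \<Rightarrow> 'e growth" is "\<lambda>f e. enat (f e)" .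

lemma growth_le_iff: "growth f \<le> growth g \<longleftrightarrow> (\<exists>N. \<forall>e. f e \<le> N * g e)"
  by transfer (simp add: dominated_def)

lemma growth_leI: "(\<And>e. f e \<le> N * g e) \<Longrightarrow> growth f \<le> growth g"
  by (auto simp: growth_le_iff)

text \<open>Sum and maximum dominate each other up to the factor 2, so closure of a set of functions
  under addition gives joins.\<close>

lemma growth_sup: "growth f \<triangledown> growth g = growth (\<lambda>e. f e + g e)"
proof (rule antisym)
  show "growth f \<triangledown> growth g \<le> growth (\<lambda>e. f e + g e)"
    by (intro sup_least growth_leI[of _ 1]) auto
  show "growth (\<lambda>e. f e + g e) \<le> growth f \<triangledown> growth g"
    by transfer (rule dominatedI[of _ 2], auto simp: max_def)
qed

lemma growth_inf: "growth f \<triangle> growth g = growth (\<lambda>e. f e - (f e - g e))"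
  by transfer (auto intro!: dominated_le simp: min_def)

lemma growth_zero: "growth (\<lambda>_. 0) = Orderings.bot"
  by transfer (auto simp: zero_enat_def intro!: dominated_le)

lemma not_top_le_growth: "\<not> Orderings.top \<le> growth f"
  by transfer (auto simp: dominated_def)

lemma supp_growth: "supp (growth f) = {e. f e \<noteq> 0}"
  by transfer (auto simp: zero_enat_def)

text \<open>At a point where y vanishes the domination reduces to \<open>f e \<le> N * g e\<close>.
  Hence y is forced to be nonzero wherever f exceeds that multiple of g.\<close>

lemma supp_difference:
  assumes "growth f \<le> growth g \<triangledown> y"
  shows "\<exists>N. \<forall>e. N * g e < f e \<longrightarrow> e \<in> supp y"
  using assms
proof transfer
  fix f g :: "'a \<Rightarrow> nat" and y
  assume "dominated (\<lambda>e. enat (f e)) (\<lambda>e. max (enat (g e)) (y e))"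
  then obtain N where N: "\<And>e. enat (f e) \<le> enat N * max (enat (g e)) (y e)"
    by (auto simp: dominated_def)
  have "f e \<le> N * g e" if "y e = 0" for e
    using N[of e] that by (simp add: max_def zero_enat_def split: if_splits)
  then show "\<exists>N. \<forall>e. N * g e < f e \<longrightarrow> e \<in> {e. y e \<noteq> 0}"
    by (meson leD mem_Collect_eq)
qed

section \<open>Cones and the growth lattices they generate\<close>

text \<open>Subtraction of naturals is truncated, so this is the positive cone of the l-group of
  integer-valued functions generated by \<open>X\<close>.\<close>

inductive_set cone :: "('e \<Rightarrow> nat) set \<Rightarrow> ('e \<Rightarrow> nat) set" for X where
  zero: "(\<lambda>_. 0) \<in> cone X"
| gen: "f \<in> X \<Longrightarrow> f \<in> cone X"
| add: "f \<in> cone X \<Longrightarrow> g \<in> cone X \<Longrightarrow> (\<lambda>e. f e + g e) \<in> cone X"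
| diff: "f \<in> cone X \<Longrightarrow> g \<in> cone X \<Longrightarrow> (\<lambda>e. f e - g e) \<in> cone X"

lemma cone_mono: "X \<subseteq> Y \<Longrightarrow> cone X \<subseteq> cone Y"
proof
  fix f assume "X \<subseteq> Y" "f \<in> cone X"
  from this(2,1) show "f \<in> cone Y"
    by induction (auto intro: cone.intros)
qed

lemma cone_mult: "f \<in> cone X \<Longrightarrow> (\<lambda>e. (N::nat) * f e) \<in> cone X"
proof (induction N)
  case 0
  show ?case by (simp add: cone.zero)
next
  case (Suc N)
  then show ?case using cone.add[of f X "\<lambda>e. N * f e"] by simp
qed

text \<open>Countably many stages exhaust the cone, each adding the sums and differences of the
  elements of the stage before.\<close>

lemma countable_cone:
  assumes "countable X"
  shows "countable (cone X)"
proof -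
  define step where "step B = B \<union> (\<lambda>(f, g) e. f e + g e) ` (B \<times> B) \<union> (\<lambda>(f, g) e. f e - g e) ` (B \<times> B)"
    for B :: "('a \<Rightarrow> nat) set"
  define A where "A n = (step ^^ n) (insert (\<lambda>_. 0) X)" for n
  have A_Suc: "A (Suc n) = step (A n)" for n by (simp add: A_def)
  have "countable (A n)" for n
  proof (induction n)
    case 0 show ?case using assms by (simp add: A_def)
  next
    case (Suc n)
    then show ?case unfolding A_Suc by (simp add: step_def)
  qed
  moreover have "cone X \<subseteq> (\<Union>n. A n)"
  proof
    have mono: "A n \<subseteq> A m" if "n \<le> m" for n m
      by (rule lift_Suc_mono_le[OF _ that]) (auto simp: A_Suc step_def)
    have op: "(\<lambda>e. f e + g e) \<in> (\<Union>n. A n) \<and> (\<lambda>e. f e - g e) \<in> (\<Union>n. A n)"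
      if fg0: "f \<in> (\<Union>n. A n)" "g \<in> (\<Union>n. A n)" for f g
    proof -
      obtain n m where "f \<in> A n" "g \<in> A m" using fg0 by blast
      then have fg: "(f, g) \<in> A (max n m) \<times> A (max n m)"
        using mono[of n "max n m"] mono[of m "max n m"] by auto
      have "(\<lambda>e. f e + g e) \<in> A (Suc (max n m))" "(\<lambda>e. f e - g e) \<in> A (Suc (max n m))"
        unfolding A_Suc step_def using imageI[OF fg, of "\<lambda>(f, g) e. f e + g e"]
          imageI[OF fg, of "\<lambda>(f, g) e. f e - g e"] by simp_all
      then show ?thesis by blast
    qed
    fix f assume "f \<in> cone X"
    then show "f \<in> (\<Union>n. A n)"
    proof induction
      case zero
      have "(\<lambda>_. 0) \<in> A 0" by (simp add: A_def)
      then show ?case by blast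
    next
      case (gen f)
      then have "f \<in> A 0" by (simp add: A_def)
      then show ?case by blast
    qed (use op in auto)
  qed
  ultimately show ?thesis using countable_subset[of "cone X" "\<Union>n. A n"] by simp
qed

text \<open>Scaling by a natural number commutes with sums and truncated differences, so
  proportionality passes from the generators to the cone.\<close>

lemma cone_homogeneous:
  assumes "f \<in> cone X" "\<And>x. x \<in> X \<Longrightarrow> x e' = r * x e"
  shows "f e' = r * f e"
  using assms(1)
  by induction (auto simp: assms(2) algebra_simps diff_mult_distrib2)

text \<open>The cone of one function contains only its multiples, and all multiples by positive
  numbers have the same growth.\<close>

lemma growth_cone_singleton:
  assumes "f \<in> cone {x}"
  shows "growth f = Orderings.bot \<or> growth f = growth x"
proof -
  have "\<exists>n. f = (\<lambda>e. n * x e)"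
    using assms
  proof induction
    case zero
    show ?case by (intro exI[of _ 0]) simp
  next
    case (gen f)
    then show ?case by (intro exI[of _ 1]) simp
  next
    case (add f g)
    then show ?case by (metis add_mult_distrib)
  next
    case (diff f g)
    then show ?case by (metis diff_mult_distrib)
  qed
  then obtain n where f: "f = (\<lambda>e. n * x e)" by blast
  show ?thesis
  proof (cases "n = 0")
    case True
    then show ?thesis using f by (simp add: growth_zero)
  next
    case False
    then have "growth f = growth x"
      unfolding f by (intro antisym growth_leI[of _ n] growth_leI[of _ 1]) auto
    then show ?thesis ..
  qed
qed

text \<open>\<open>top\<close> is adjoined to make the lattice bounded, as no finite-valued function
  reaches it. It is the same for every X, so inclusions preserve the bounds.\<close>

definition growth_lattice :: "('e \<Rightarrow> nat) set \<Rightarrow> 'e growth set" where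
  "growth_lattice X = insert Orderings.top (growth ` cone X)"

lemma growth_latticeE:
  assumes "x \<in> growth_lattice X"
  obtains "x = Orderings.top" | f where "f \<in> cone X" "x = growth f"
  using assms by (auto simp: growth_lattice_def)

lemma growth_lattice_growth: "f \<in> cone X \<Longrightarrow> growth f \<in> growth_lattice X"
  by (simp add: growth_lattice_def)

lemma growth_lattice_top: "Orderings.top \<in> growth_lattice X"
  by (simp add: growth_lattice_def)

lemma growth_lattice_bot: "Orderings.bot \<in> growth_lattice X"
  using growth_lattice_growth[OF cone.zero] by (simp add: growth_zero)

lemma growth_lattice_mono: "X \<subseteq> Y \<Longrightarrow> growth_lattice X \<subseteq> growth_lattice Y"
  unfolding growth_lattice_def by (intro insert_mono image_mono cone_mono)

lemma growth_lattice_sup: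
  "x \<in> growth_lattice X \<Longrightarrow> y \<in> growth_lattice X \<Longrightarrow> x \<triangledown> y \<in> growth_lattice X"
  by (auto elim!: growth_latticeE simp: growth_sup growth_lattice_top intro!: growth_lattice_growth cone.add)

lemma growth_lattice_inf:
  "x \<in> growth_lattice X \<Longrightarrow> y \<in> growth_lattice X \<Longrightarrow> x \<triangle> y \<in> growth_lattice X"
  by (auto elim!: growth_latticeE simp: growth_inf growth_lattice_top intro!: growth_lattice_growth cone.diff)

text \<open>The truncated difference makes up for what \<open>N * g\<close> fails to cover. N = 1
  gives complete normality, while larger N provide smaller and smaller differences.\<close>

lemma growth_le_difference: "growth f \<le> growth g \<triangledown> growth (\<lambda>e. f e - N * g e)"
  unfolding growth_sup
proof (rule growth_leI)
  fix e
  define k where "k = f e - N * g e"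
  have "f e \<le> N * g e + k" by (simp add: k_def)
  also have "\<dots> \<le> (N + 1) * (g e + k)" by (simp add: algebra_simps)
  finally show "f e \<le> (N + 1) * (g e + (f e - N * g e))" by (simp add: k_def)
qed

text \<open>The positive parts of f - g and g - f have disjoint supports. If x or y is
  \<open>top\<close>, the elements \<open>top\<close> and \<open>bot\<close> serve as
  witnesses.\<close>

lemma growth_lattice_normal:
  assumes "x \<in> growth_lattice X" "y \<in> growth_lattice X"
  shows "\<exists>u\<in>growth_lattice X. \<exists>v\<in>growth_lattice X.
    x \<le> y \<triangledown> u \<and> y \<le> x \<triangledown> v \<and> u \<triangle> v = Orderings.bot"
proof -
  consider "x = Orderings.top" | "y = Orderings.top"
    | f g where "f \<in> cone X" "x = growth f" "g \<in> cone X" "y = growth g"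
    using assms by (elim growth_latticeE) auto
  then show ?thesis
  proof cases
    case 1
    then show ?thesis
      by - (rule bexI[of _ Orderings.top], rule bexI[of _ Orderings.bot],
        auto simp: growth_lattice_top growth_lattice_bot)
  next
    case 2
    then show ?thesis
      by - (rule bexI[of _ Orderings.bot], rule bexI[of _ Orderings.top],
        auto simp: growth_lattice_top growth_lattice_bot)
  next
    case 3
    have "growth (\<lambda>e. f e - g e) \<triangle> growth (\<lambda>e. g e - f e) = Orderings.bot"
      unfolding growth_inf growth_zero[symmetric] by (rule arg_cong[of _ _ growth]) auto
    moreover have "growth (\<lambda>e. f e - g e) \<in> growth_lattice X" "growth (\<lambda>e. g e - f e) \<in> growth_lattice X"
      using 3 by (auto intro!: growth_lattice_growth cone.diff)
    ultimately show ?thesis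
      using growth_le_difference[of f g 1] growth_le_difference[of g f 1] 3(2,4) by auto
  qed
qed

text \<open>If \<open>f \<le> N * (g + h)\<close>, then the positive part of
  \<open>f - N * g\<close> stays below \<open>N * h\<close>. It is built from f and g alone and so
  lies in the lattice of X even when y comes from another lattice.\<close>

lemma growth_lattice_difference:
  assumes "a \<in> growth_lattice X" "b \<in> growth_lattice X" "y \<in> growth_lattice Y" "a \<le> b \<triangledown> y"
  shows "\<exists>x\<in>growth_lattice X. a \<le> b \<triangledown> x \<and> x \<le> y"
proof -
  consider "b = Orderings.top" | "y = Orderings.top"
    | g h where "g \<in> cone X" "b = growth g" "h \<in> cone Y" "y = growth h"
    using assms by (elim growth_latticeE) auto
  then show ?thesis
  proof cases
    case 1
    then show ?thesis by (intro bexI[of _ Orderings.bot]) (auto simp: growth_lattice_bot)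
  next
    case 2
    then show ?thesis by (intro bexI[of _ Orderings.top]) (auto simp: growth_lattice_top)
  next
    case 3
    then have "a \<noteq> Orderings.top"
      using assms(4) not_top_le_growth by (auto simp: growth_sup)
    then obtain f where f: "f \<in> cone X" "a = growth f"
      using assms(1) by (auto elim: growth_latticeE)
    obtain N where N: "\<And>e. f e \<le> N * (g e + h e)"
      using assms(4) unfolding f 3 growth_sup growth_le_iff by blast
    have "f e - N * g e \<le> N * h e" for e
      using N[of e] by (simp add: distrib_left le_diff_conv add.commute)
    then have "growth (\<lambda>e. f e - N * g e) \<le> growth h" by (rule growth_leI)
    moreover have "growth (\<lambda>e. f e - N * g e) \<in> growth_lattice X"
      using f 3 by (intro growth_lattice_growth cone.diff cone_mult)
    ultimately show ?thesis using f 3 growth_le_difference by blast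
  qed
qed

text \<open>Functions in the cone vanish at both points or at neither, by proportionality. A support
  thus sees only the ratio of the generators.\<close>

lemma supp_homogeneous:
  assumes "y \<in> growth_lattice X" "\<And>x. x \<in> X \<Longrightarrow> x e' = r * x e" "r \<noteq> 0"
  shows "e \<in> supp y \<longleftrightarrow> e' \<in> supp y"
  using assms(1)
proof (cases rule: growth_latticeE)
  case 1
  then show ?thesis by (simp add: supp_top)
next
  case (2 f)
  have "f e' = r * f e" by (rule cone_homogeneous[OF 2(1)]) (rule assms(2))
  then show ?thesis using 2(2) assms(3) by (simp add: supp_growth)
qed

section \<open>A triangle of growth lattices\<close>

type_synonym pt = "nat \<times> nat \<times> nat \<times> bool"

definition pA :: "pt \<Rightarrow> nat" where "pA = (\<lambda>(a, b, c, t). a)"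
definition pB :: "pt \<Rightarrow> nat" where "pB = (\<lambda>(a, b, c, t). b)"
definition pC :: "pt \<Rightarrow> nat" where "pC = (\<lambda>(a, b, c, t). c)"
definition pA' :: "pt \<Rightarrow> nat" where "pA' = (\<lambda>(a, b, c, t). if t then 4 * a else a)"

definition vertex :: "ix \<Rightarrow> pt \<Rightarrow> nat" where
  "vertex i = (case i of I1 \<Rightarrow> pA | I2 \<Rightarrow> pB | I3 \<Rightarrow> pC)"

text \<open>
  The vertex \<^term>\<open>I1\<close> is represented by \<^term>\<open>pA\<close> on one edge and by \<^term>\<open>pA'\<close> on the
  other. These functions have the same growth, so that the lattices below increase with the
  set, but the ratio of \<^term>\<open>pA'\<close> to \<^term>\<open>pC\<close> is not determined by the ratios on the
  other two edges.
\<close>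

definition gens :: "ix set \<Rightarrow> (pt \<Rightarrow> nat) set" where
  "gens S = {vertex i |i. S = {i}} \<union> (if {I1, I2} \<subseteq> S then {pA, pB} else {}) \<union>
    (if {I2, I3} \<subseteq> S then {pB, pC} else {}) \<union> (if {I1, I3} \<subseteq> S then {pA', pC} else {})"

definition triangle :: "ix set \<Rightarrow> pt growth set" where
  "triangle S = growth_lattice (gens S)"

lemma growth_pA': "growth pA' = growth pA"
  by (intro antisym growth_leI[of _ 4] growth_leI[of _ 1]) (auto simp: pA_def pA'_def)

text \<open>On a larger set some edge at i supplies the generator; for I1 on the edge to I3 it is
  \<open>pA'\<close>, of the same growth as \<open>pA\<close>.\<close>

lemma vertex_triangle:
  assumes "i \<in> S"
  shows "growth (vertex i) \<in> triangle S"
proof -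
  have "\<exists>f\<in>gens S. growth f = growth (vertex i)"
  proof (cases "S = {i}")
    case True
    then show ?thesis by (auto simp: gens_def)
  next
    case False
    then obtain j where "j \<in> S" "j \<noteq> i" using assms by auto
    then show ?thesis
      using assms by (cases i; cases j) (auto simp: gens_def vertex_def growth_pA')
  qed
  then show ?thesis
    unfolding triangle_def by (metis cone.gen growth_lattice_growth)
qed

text \<open>The generators grow with the set except from a single vertex, as \<open>pA\<close> is
  not a generator over the edge from I1 to I3. But the lattice of one vertex has no elements besides
  the bounds and the growth of its generator, which occurs in every larger lattice.\<close>

lemma triangle_mono:
  assumes "S \<subseteq> T"
  shows "triangle S \<subseteq> triangle T"
proof (cases "\<exists>i. S = {i}")
  case True
  then obtain i where i: "S = {i}" by blast
  have "gens S = {vertex i}" by (auto simp: gens_def i)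
  then have "y = Orderings.top \<or> y = Orderings.bot \<or> y = growth (vertex i)" if "y \<in> triangle S" for y
    using that growth_cone_singleton[of _ "vertex i"]
    by (auto simp: triangle_def growth_lattice_def)
  moreover have "growth (vertex i) \<in> triangle T" using vertex_triangle assms i by blast
  ultimately show ?thesis
    unfolding triangle_def using growth_lattice_top growth_lattice_bot by blast
next
  case False
  then have "gens S \<subseteq> gens T" using assms by (auto simp: gens_def)
  then show ?thesis unfolding triangle_def by (rule growth_lattice_mono)
qed

lemma finite_gens: "finite (gens S)"
proof -
  have "vertex i \<in> {pA, pB, pC}" for i by (cases i) (auto simp: vertex_def)
  then have "gens S \<subseteq> {pA, pB, pC, pA'}" by (auto simp: gens_def)
  then show ?thesis by (rule finite_subset) simp
qed

lemma stalks_triangle: "stalks triangle"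
proof
  show "countable (triangle S)" for S
    unfolding triangle_def growth_lattice_def
    by (intro countable_insert countable_image countable_cone countable_finite finite_gens)
  show "triangle S \<subseteq> triangle T" if "S \<subseteq> T" for S T using triangle_mono that .
qed (unfold triangle_def, (rule growth_lattice_sup growth_lattice_inf growth_lattice_bot
    growth_lattice_top growth_lattice_normal growth_lattice_difference; assumption)+)

lemma last_true:
  assumes "P 0" "\<not> P m"
  obtains i :: nat where "P i" "\<not> P (Suc i)"
  using assms by (induction m) auto

text \<open>Read \<open>e \<in> supp (x i j)\<close> as i beating j at e. On each edge this depends
  only on a ratio, so there are exponents where 2 stops beating 1 and where 3 stops beating 2. A
  point before both changes and a point after both can share \<open>pA'\<close> and
  \<open>pC\<close>, yet transitivity forces opposite results for 3 against 1.\<close>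

lemma no_triangle_choice:
  assumes mem: "\<And>i j. i \<noteq> j \<Longrightarrow> x i j \<in> triangle {i, j}"
    and le: "\<And>i j. i \<noteq> j \<Longrightarrow> growth (vertex i) \<le> growth (vertex j) \<triangledown> x i j"
    and disj: "\<And>i j. i \<noteq> j \<Longrightarrow> x i j \<triangle> x j i = Orderings.bot"
    and tri: "\<And>i j k. x i k \<le> x i j \<triangledown> x j k"
  shows False
proof -
  have "\<forall>i j. \<exists>N. i \<noteq> j \<longrightarrow> (\<forall>e. N * vertex j e < vertex i e \<longrightarrow> e \<in> supp (x i j))"
    using supp_difference[OF le] by blast
  then obtain N where N: "\<And>i j e. i \<noteq> j \<Longrightarrow> N i j * vertex j e < vertex i e \<Longrightarrow> e \<in> supp (x i j)"
    by metis
  \<comment> \<open>A ratio of \<open>2 ^ M\<close> exceeds all four constants and thereby decides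
    the comparison.\<close>
  define M where "M = N I1 I2 + N I2 I1 + N I2 I3 + N I3 I2"
  have "M < 2 ^ M" by (rule less_exp)
  moreover have "N I1 I2 \<le> M" "N I2 I1 \<le> M" "N I2 I3 \<le> M" "N I3 I2 \<le> M"
    by (auto simp: M_def)
  ultimately have M: "N I1 I2 < 2 ^ M" "N I2 I1 < 2 ^ M" "N I2 I3 < 2 ^ M" "N I3 I2 < 2 ^ M"
    by linarith+
  have disj': "e \<notin> supp (x i j)" if "i \<noteq> j" "e \<in> supp (x j i)" for i j e
    using disj[OF that(1)] that(2) supp_inf[of "x i j" "x j i"] by (auto simp: supp_bot)
  have tri': "e \<in> supp (x i j) \<or> e \<in> supp (x j k)" if "e \<in> supp (x i k)" for i j k e
    using supp_mono[OF tri[of i k j]] that by (auto simp: supp_sup)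
  have gens: "gens {I2, I1} = {pA, pB}" "gens {I3, I2} = {pB, pC}" "gens {I3, I1} = {pA', pC}"
    by (auto simp: gens_def doubleton_eq_iff)
  note p_defs = pA_def pB_def pC_def pA'_def
  \<comment> \<open>The ratios \<open>a : b\<close> for f and \<open>b : c\<close> for g run through
    \<open>2 ^ i : 2 ^ M\<close>. The coordinate 0 is a placeholder that the generators of the edge
    do not read.\<close>
  define f where "f i \<longleftrightarrow> (2 ^ i, 2 ^ M, 0, False) \<in> supp (x I2 I1)" for i
  define g where "g i \<longleftrightarrow> (0, 2 ^ i, 2 ^ M, False) \<in> supp (x I3 I2)" for i
  \<comment> \<open>The common factor \<open>2 ^ j\<close> allows \<open>a : b\<close> and
    \<open>b : c\<close> to be prescribed at the same point.\<close>
  have f_iff: "(2 ^ (i + j), 2 ^ (j + M), c, t) \<in> supp (x I2 I1) \<longleftrightarrow> f i" for i j c t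
    unfolding f_def
    by (rule sym, rule supp_homogeneous[of _ "gens {I2, I1}" _ "2 ^ j"])
      (use mem[of I2 I1] in \<open>auto simp: triangle_def gens p_defs power_add\<close>)
  have g_iff: "(a, 2 ^ (j + M), 2 ^ (M + M), t) \<in> supp (x I3 I2) \<longleftrightarrow> g j" for j a t
    unfolding g_def
    by (rule sym, rule supp_homogeneous[of _ "gens {I3, I2}" _ "2 ^ M"])
      (use mem[of I3 I2] in \<open>auto simp: triangle_def gens p_defs power_add\<close>)
  have "f 0" unfolding f_def by (rule N) (auto simp: vertex_def p_defs M)
  \<comment> \<open>Now a is \<open>2 ^ M\<close> times b, so 1 beats 2, and disjointness excludes
    the converse.\<close>
  moreover have "\<not> f (M + M)"
    unfolding f_def by (rule disj', simp, rule N) (auto simp: vertex_def p_defs M power_add)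
  ultimately obtain i where i: "f i" "\<not> f (Suc i)" by (rule last_true)
  have "g 0" unfolding g_def by (rule N) (auto simp: vertex_def p_defs M)
  moreover have "\<not> g (M + M)"
    unfolding g_def by (rule disj', simp, rule N) (auto simp: vertex_def p_defs M power_add)
  ultimately obtain j where j: "g j" "\<not> g (Suc j)" by (rule last_true)
  \<comment> \<open>P has the ratios just before both changes, Q those just after. From P to Q the
    entry a grows by the factor 4 and c is kept; the flag compensates for this factor in a'.\<close>
  let ?P = "(2 ^ (i + j), 2 ^ (j + M), 2 ^ (M + M), True)"
    and ?Q = "(2 ^ (Suc i + Suc j), 2 ^ (Suc j + M), 2 ^ (M + M), False)"
  have "?P \<in> supp (x I2 I1)" "?P \<in> supp (x I3 I2)" using i(1) j(1) f_iff g_iff by blast+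
  \<comment> \<open>Since 2 beats 1, the triangle inequality makes 2 beat 3 or 3 beat 1, and the
    former is excluded because 3 beats 2.\<close>
  then have "?P \<in> supp (x I3 I1)"
    using tri'[of ?P I2 I1 I3] disj'[of I2 I3 ?P] by blast
  moreover have "?Q \<notin> supp (x I2 I1)" "?Q \<notin> supp (x I3 I2)" using i(2) j(2) f_iff g_iff by blast+
  then have "?Q \<notin> supp (x I3 I1)" using tri'[of ?Q I3 I1 I2] by blast
  moreover have "?P \<in> supp (x I3 I1) \<longleftrightarrow> ?Q \<in> supp (x I3 I1)"
    by (rule supp_homogeneous[of _ "gens {I3, I1}" _ 1])
      (use mem[of I3 I1] in \<open>auto simp: triangle_def gens p_defs\<close>)
  ultimately show False by blast
qed

section \<open>The non-Cevian lattice of cardinality aleph-two\<close>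

lemma exists_non_cevian:
  "\<exists>B :: nat set set gorder.
    bounded_lattice B \<and> completely_normal B \<and> countably_based_differences B \<and>
    has_card_aleph2 (carrier B) \<and> \<not> cevian B"
proof -
  interpret stalks triangle by (rule stalks_triangle)
  let ?w2 = "cardSuc (cardSuc natLeq)"
  \<comment> \<open>Each \<open>cardSuc\<close> adds one \<open>set\<close> to the underlying type,
    so the elements of \<open>W\<close> have type \<open>nat set set\<close>. \<open>W\<close>
    serves both as index set and as carrier of the copied lattice.\<close>
  define W where "W = Field ?w2"
  have co: "Card_order (cardSuc natLeq)" "Card_order ?w2"
    by (simp_all add: cardSuc_Card_order natLeq_Card_order)
  have W: "|W| =o ?w2" unfolding W_def by (rule card_of_Field_ordIso[OF co(2)])
  have le_W: "?w2 \<le>o |W|" by (rule ordIso_imp_ordLeq[OF ordIso_symmetric[OF W]])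
  have "natLeq \<le>o cardSuc natLeq" "cardSuc natLeq \<le>o ?w2"
    using co by (simp_all add: cardSuc_ordLeq natLeq_Card_order)
  then have "natLeq \<le>o |W|"
    using ordLeq_transitive[OF ordLeq_transitive le_W] by blast
  then have infW: "infinite W" using infinite_iff_natLeq_ordLeq by blast
  let ?A = "sections W :: ((ix \<rightharpoonup> nat set set) \<Rightarrow> pt growth) set"
  let ?a = "\<lambda>i. growth (vertex i)"
  have "(1, 0, 0, True) \<in> supp (?a I1)" by (simp add: supp_growth vertex_def pA_def)
  then have "?a I1 \<noteq> Orderings.bot" using supp_bot by fastforce
  then have "|W| \<le>o |?A|"
    using card_of_sections_ge[where a = ?a and j = I1] vertex_triangle[of I1 "{I1}"] by simp
  moreover have "|?A| \<le>o |W|" by (rule card_of_sections_le[OF infW])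
  ultimately have card: "|?A| =o |W|" by (simp add: ordIso_iff_ordLeq)
  then obtain k where k: "bij_betw k ?A W" using card_of_ordIso by blast
  then have inj: "inj_on k ?A" by (rule bij_betw_imp_inj_on)
  interpret copied_sublattice ?A k
    by unfold_locales (auto simp: inj sup_sections inf_sections bot_sections top_sections)
  have "\<not> cevian B"
  proof
    assume "cevian B"
    then obtain d where d: "\<And>x y. x \<in> ?A \<Longrightarrow> y \<in> ?A \<Longrightarrow> d x y \<in> ?A"
      "\<And>x y. x \<in> ?A \<Longrightarrow> y \<in> ?A \<Longrightarrow> x \<le> y \<triangledown> d x y"
      "\<And>x y. x \<in> ?A \<Longrightarrow> y \<in> ?A \<Longrightarrow> d x y \<triangle> d y x = Orderings.bot"
      "\<And>x y z. x \<in> ?A \<Longrightarrow> y \<in> ?A \<Longrightarrow> z \<in> ?A \<Longrightarrow> d x z \<le> d x y \<triangledown> d y z"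
      using cevian_B by blast
    show False
    proof (rule no_cevian_sections[where a = ?a and d = d, OF stalks_triangle le_W])
      show "?a j \<in> triangle {j}" for j using vertex_triangle by blast
    next
      fix x :: "ix \<Rightarrow> ix \<Rightarrow> pt growth"
      assume "\<And>i j. i \<noteq> j \<Longrightarrow> x i j \<in> triangle {i, j}"
        "\<And>i j. i \<noteq> j \<Longrightarrow> ?a i \<le> ?a j \<triangledown> x i j"
        "\<And>i j. i \<noteq> j \<Longrightarrow> x i j \<triangle> x j i = Orderings.bot"
        "\<And>i j k. x i k \<le> x i j \<triangledown> x j k"
      then show False by (rule no_triangle_choice)
    qed (use d in auto)
  qed
  moreover have "has_card_aleph2 (carrier B)"
    using k W unfolding has_card_aleph2_def carrier_B by (simp add: bij_betw_imp_surj_on)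
  moreover have "completely_normal B"
    by (rule completely_normal_B) (rule normal_sections)
  moreover have "countably_based_differences B"
    by (rule countably_based_differences_B) (rule countably_based_sections)
  ultimately show ?thesis using bounded_lattice_B by blast
qed

section \<open>Lattices of convex subgroups\<close>

context l_group
begin

abbreviation Ord where "Ord \<equiv> order_of G"

lemma carrier_O: "carrier Ord = carrier G" and le_O: "le Ord = leq G"
  by (simp_all add: order_of_def)

lemma leq_refl: "x \<in> carrier G \<Longrightarrow> x \<preceq> x"
proof -
  interpret Ord: Lattice.lattice Ord by (rule lattice_order)
  show "x \<in> carrier G \<Longrightarrow> x \<preceq> x" using Ord.le_refl by (simp add: carrier_O le_O)
qed

lemma leq_trans:
  "x \<preceq> y \<Longrightarrow> y \<preceq> z \<Longrightarrow> x \<in> carrier G \<Longrightarrow> y \<in> carrier G \<Longrightarrow> z \<in> carrier G \<Longrightarrow> x \<preceq> z"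
proof -
  interpret Ord: Lattice.lattice Ord by (rule lattice_order)
  show "x \<preceq> y \<Longrightarrow> y \<preceq> z \<Longrightarrow> x \<in> carrier G \<Longrightarrow> y \<in> carrier G \<Longrightarrow> z \<in> carrier G \<Longrightarrow> x \<preceq> z"
    using Ord.le_trans[of x y z] by (simp add: carrier_O le_O)
qed

lemma leq_antisym: "x \<preceq> y \<Longrightarrow> y \<preceq> x \<Longrightarrow> x \<in> carrier G \<Longrightarrow> y \<in> carrier G \<Longrightarrow> x = y"
proof -
  interpret Ord: Lattice.lattice Ord by (rule lattice_order)
  show "x \<preceq> y \<Longrightarrow> y \<preceq> x \<Longrightarrow> x \<in> carrier G \<Longrightarrow> y \<in> carrier G \<Longrightarrow> x = y"
    using Ord.le_antisym[of x y] by (simp add: carrier_O le_O)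
qed

lemma
  assumes "x \<in> carrier G" "y \<in> carrier G"
  shows join_closed: "x \<squnion>\<^bsub>Ord\<^esub> y \<in> carrier G"
    and join_left: "x \<preceq> x \<squnion>\<^bsub>Ord\<^esub> y" and join_right: "y \<preceq> x \<squnion>\<^bsub>Ord\<^esub> y"
    and meet_closed: "x \<sqinter>\<^bsub>Ord\<^esub> y \<in> carrier G"
    and meet_left: "x \<sqinter>\<^bsub>Ord\<^esub> y \<preceq> x" and meet_right: "x \<sqinter>\<^bsub>Ord\<^esub> y \<preceq> y"
proof -
  interpret Ord: Lattice.lattice Ord by (rule lattice_order)
  show "x \<squnion>\<^bsub>Ord\<^esub> y \<in> carrier G" "x \<preceq> x \<squnion>\<^bsub>Ord\<^esub> y" "y \<preceq> x \<squnion>\<^bsub>Ord\<^esub> y"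
    "x \<sqinter>\<^bsub>Ord\<^esub> y \<in> carrier G" "x \<sqinter>\<^bsub>Ord\<^esub> y \<preceq> x" "x \<sqinter>\<^bsub>Ord\<^esub> y \<preceq> y"
    using assms Ord.join_closed[of x y] Ord.join_left[of x y] Ord.join_right[of x y]
      Ord.meet_closed[of x y] Ord.meet_left[of x y] Ord.meet_right[of x y]
    by (simp_all add: carrier_O le_O)
qed

lemma
  assumes "x \<in> carrier G" "y \<in> carrier G" "z \<in> carrier G"
  shows join_least: "x \<preceq> z \<Longrightarrow> y \<preceq> z \<Longrightarrow> x \<squnion>\<^bsub>Ord\<^esub> y \<preceq> z"
    and meet_greatest: "z \<preceq> x \<Longrightarrow> z \<preceq> y \<Longrightarrow> z \<preceq> x \<sqinter>\<^bsub>Ord\<^esub> y"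
proof -
  interpret Ord: Lattice.lattice Ord by (rule lattice_order)
  show "x \<preceq> z \<Longrightarrow> y \<preceq> z \<Longrightarrow> x \<squnion>\<^bsub>Ord\<^esub> y \<preceq> z" "z \<preceq> x \<Longrightarrow> z \<preceq> y \<Longrightarrow> z \<preceq> x \<sqinter>\<^bsub>Ord\<^esub> y"
    using assms Ord.join_le[of x z y] Ord.meet_le[of z x y] by (simp_all add: carrier_O le_O)
qed

lemma mult_mono:
  assumes "x \<preceq> x'" "y \<preceq> y'" "x \<in> carrier G" "x' \<in> carrier G" "y \<in> carrier G" "y' \<in> carrier G"
  shows "x \<otimes> y \<preceq> x' \<otimes> y'"
  using assms mult_right_mono[of x x' y] mult_left_mono[of y y' x'] leq_trans by (meson m_closed)

lemma inv_anti:
  assumes "x \<preceq> y" "x \<in> carrier G" "y \<in> carrier G"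
  shows "inv y \<preceq> inv x"
proof -
  have "inv x \<otimes> x \<otimes> inv y \<preceq> inv x \<otimes> y \<otimes> inv y"
    using assms by (intro mult_right_mono mult_left_mono) auto
  then show ?thesis using assms by (simp add: m_assoc)
qed

lemma leq_mult_right: "\<one> \<preceq> y \<Longrightarrow> x \<in> carrier G \<Longrightarrow> y \<in> carrier G \<Longrightarrow> x \<preceq> x \<otimes> y"
  using mult_left_mono[of \<one> y x] by simp

lemma leq_mult_left: "\<one> \<preceq> y \<Longrightarrow> x \<in> carrier G \<Longrightarrow> y \<in> carrier G \<Longrightarrow> x \<preceq> y \<otimes> x"
  using mult_right_mono[of \<one> y x] by simp

lemma one_leq_mult:
  "\<one> \<preceq> x \<Longrightarrow> \<one> \<preceq> y \<Longrightarrow> x \<in> carrier G \<Longrightarrow> y \<in> carrier G \<Longrightarrow> \<one> \<preceq> x \<otimes> y"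
  using leq_mult_right[of y x] leq_trans[of \<one> x "x \<otimes> y"] by simp

section \<open>Positive parts and orthogonality\<close>

definition pos where "pos x = x \<squnion>\<^bsub>Ord\<^esub> \<one>"

lemma pos_closed: "x \<in> carrier G \<Longrightarrow> pos x \<in> carrier G"
  by (simp add: pos_def join_closed)

lemma leq_pos: "x \<in> carrier G \<Longrightarrow> x \<preceq> pos x"
  by (simp add: pos_def join_left)

lemma one_leq_pos: "x \<in> carrier G \<Longrightarrow> \<one> \<preceq> pos x"
  by (simp add: pos_def join_right)

lemma pos_least: "x \<preceq> z \<Longrightarrow> \<one> \<preceq> z \<Longrightarrow> x \<in> carrier G \<Longrightarrow> z \<in> carrier G \<Longrightarrow> pos x \<preceq> z"
  by (simp add: pos_def join_least)

text \<open>The right-hand side bounds both \<open>x \<otimes> y\<close> and the unit. This becomes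
  the triangle inequality of the Cevian operation.\<close>

lemma pos_mult:
  assumes "x \<in> carrier G" "y \<in> carrier G"
  shows "pos (x \<otimes> y) \<preceq> pos x \<otimes> pos y"
  using assms by (intro pos_least mult_mono one_leq_mult) (auto simp: leq_pos one_leq_pos pos_closed)

text \<open>For positive elements this says that their meet is the unit.\<close>

definition orth where
  "orth a b \<longleftrightarrow> (\<forall>w\<in>carrier G. w \<preceq> a \<longrightarrow> w \<preceq> b \<longrightarrow> w \<preceq> \<one>)"

lemma orth_sym: "orth a b \<Longrightarrow> orth b a"
  by (auto simp: orth_def)

lemma orth_mono: "orth a v \<Longrightarrow> a' \<preceq> a \<Longrightarrow> a \<in> carrier G \<Longrightarrow> a' \<in> carrier G \<Longrightarrow> orth a' v"
  unfolding orth_def using leq_trans by blast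

lemma orth_one: "orth \<one> v"
  by (simp add: orth_def)

text \<open>For w below \<open>a \<otimes> b\<close> and v, the element
  \<open>inv a \<otimes> w\<close> is below b and, a being positive, below v. Orthogonality of b and
  v then puts w below a, and that of a and v finishes without interchanging factors.\<close>

lemma orth_mult:
  assumes "orth a v" "orth b v" "\<one> \<preceq> a" "a \<in> carrier G" "b \<in> carrier G" "v \<in> carrier G"
  shows "orth (a \<otimes> b) v"
  unfolding orth_def
proof (intro ballI impI)
  fix w assume w: "w \<in> carrier G" "w \<preceq> a \<otimes> b" "w \<preceq> v"
  have "inv a \<otimes> w \<preceq> inv a \<otimes> (a \<otimes> b)" using w assms by (intro mult_left_mono) auto
  then have 1: "inv a \<otimes> w \<preceq> b" using assms by (simp add: m_assoc[symmetric])
  have "inv a \<preceq> \<one>" using inv_anti[OF assms(3)] assms by simp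
  then have "inv a \<otimes> w \<preceq> w" using mult_right_mono[of "inv a" \<one> w] w assms by simp
  then have "inv a \<otimes> w \<preceq> v" using w assms by (meson leq_trans inv_closed m_closed)
  then have "inv a \<otimes> w \<preceq> \<one>" using 1 assms w by (simp add: orth_def)
  then have "a \<otimes> (inv a \<otimes> w) \<preceq> a \<otimes> \<one>" using assms w by (intro mult_left_mono) auto
  then have "w \<preceq> a" using assms w by (simp add: m_assoc[symmetric])
  then show "w \<preceq> \<one>" using w assms(1) by (simp add: orth_def)
qed

text \<open>From \<open>w \<preceq> pos x \<preceq> x \<otimes> ?v\<close> and
  \<open>w \<preceq> ?v\<close>, the element \<open>?v \<otimes> inv w\<close> is above
  \<open>inv x\<close> and the unit, hence above \<open>?v\<close>, which can be cancelled.\<close>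

lemma orth_pos_inv:
  assumes "x \<in> carrier G"
  shows "orth (pos x) (pos (inv x))"
  unfolding orth_def
proof (intro ballI impI)
  let ?v = "pos (inv x)"
  note c = assms pos_closed inv_closed m_closed
  fix w assume w: "w \<in> carrier G" "w \<preceq> pos x" "w \<preceq> ?v"
  have "x \<otimes> inv x \<preceq> x \<otimes> ?v" using c by (intro mult_left_mono leq_pos) auto
  then have "pos x \<preceq> x \<otimes> ?v"
    using c by (intro pos_least leq_mult_right one_leq_pos) auto
  then have "w \<preceq> x \<otimes> ?v" using w c by (meson leq_trans)
  then have "inv (x \<otimes> ?v) \<preceq> inv w" using w c by (intro inv_anti) auto
  then have "?v \<otimes> inv (x \<otimes> ?v) \<preceq> ?v \<otimes> inv w" using w c by (intro mult_left_mono) auto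
  then have 1: "inv x \<preceq> ?v \<otimes> inv w"
    using c by (simp add: inv_mult_group m_assoc[symmetric])
  have "w \<otimes> inv w \<preceq> ?v \<otimes> inv w" using w c by (intro mult_right_mono) auto
  then have "?v \<preceq> ?v \<otimes> inv w" using 1 w c by (intro pos_least) auto
  then have "inv ?v \<otimes> ?v \<preceq> inv ?v \<otimes> (?v \<otimes> inv w)" using w c by (intro mult_left_mono) auto
  then have "\<one> \<preceq> inv w" using w c by (simp add: m_assoc[symmetric])
  then show "w \<preceq> \<one>" using inv_anti[of \<one> "inv w"] w by simp
qed

section \<open>Convex subgroups and their principal generators\<close>

lemma convex_subgroup: "convex_l_subgroup H G \<Longrightarrow> subgroup H G"
  unfolding convex_l_subgroup_def by blast

lemma convex_one: "convex_l_subgroup H G \<Longrightarrow> \<one> \<in> H"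
  by (rule subgroup.one_closed[OF convex_subgroup])

lemma convex_pos: "convex_l_subgroup H G \<Longrightarrow> x \<in> H \<Longrightarrow> pos x \<in> H"
  using convex_one[of H] unfolding convex_l_subgroup_def pos_def by blast

lemma convexD:
  "convex_l_subgroup H G \<Longrightarrow> x \<in> H \<Longrightarrow> z \<in> H \<Longrightarrow> x \<preceq> y \<Longrightarrow> y \<preceq> z \<Longrightarrow> y \<in> carrier G \<Longrightarrow> y \<in> H"
  unfolding convex_l_subgroup_def by blast

lemma convex_positiveD:
  "convex_l_subgroup H G \<Longrightarrow> z \<in> H \<Longrightarrow> \<one> \<preceq> y \<Longrightarrow> y \<preceq> z \<Longrightarrow> y \<in> carrier G \<Longrightarrow> y \<in> H"
  using convexD convex_one by blast

text \<open>The product stands for the absolute value of x. It bounds both of its factors, and x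
  lies between \<open>inv (pos (inv x))\<close> and \<open>pos x\<close>.\<close>

lemma convex_mem_iff:
  assumes H: "convex_l_subgroup H G" and x: "x \<in> carrier G"
  shows "x \<in> H \<longleftrightarrow> pos x \<otimes> pos (inv x) \<in> H"
proof
  interpret subgroup H G by (rule convex_subgroup[OF H])
  show "x \<in> H \<Longrightarrow> pos x \<otimes> pos (inv x) \<in> H" by (simp add: convex_pos[OF H])
  note c = x pos_closed Group.group.inv_closed[OF is_group]
  assume a: "pos x \<otimes> pos (inv x) \<in> H"
  have p: "pos x \<in> H"
    by (rule convex_positiveD[OF H a]) (simp_all add: c one_leq_pos leq_mult_right)
  have "pos (inv x) \<in> H"
    by (rule convex_positiveD[OF H a]) (simp_all add: c one_leq_pos leq_mult_left)
  then have n: "inv (pos (inv x)) \<in> H" by simp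
  have "inv (pos (inv x)) \<preceq> x"
    using inv_anti[OF leq_pos[of "inv x"]] by (simp add: c)
  then show "x \<in> H" using convexD[OF H n p _ leq_pos] x by simp
qed

text \<open>The product of the absolute values of the generators is a single positive generator. It
  is the same for all H, so \<open>Cs_c\<close> and \<open>Id_c\<close> can be treated
  alike.\<close>

lemma principal:
  assumes "finite X" "X \<subseteq> carrier G"
  shows "\<exists>g\<in>carrier G. \<one> \<preceq> g \<and> (\<forall>H. convex_l_subgroup H G \<longrightarrow> (X \<subseteq> H \<longleftrightarrow> g \<in> H))"
  using assms
proof (induction X)
  case empty
  show ?case
    by (intro bexI[of _ \<one>]) (auto simp: leq_refl convex_one)
next
  case (insert x F)
  then obtain g where g: "g \<in> carrier G" "\<one> \<preceq> g"
      "\<And>H. convex_l_subgroup H G \<Longrightarrow> F \<subseteq> H \<longleftrightarrow> g \<in> H" by auto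
  let ?a = "pos x \<otimes> pos (inv x)"
  have x: "x \<in> carrier G" using insert by simp
  then have a: "?a \<in> carrier G" "\<one> \<preceq> ?a"
    by (simp_all add: pos_closed one_leq_pos one_leq_mult)
  have "insert x F \<subseteq> H \<longleftrightarrow> g \<otimes> ?a \<in> H" if H: "convex_l_subgroup H G" for H
  proof -
    have "subgroup H G" by (rule convex_subgroup[OF H])
    moreover have "g \<in> H" "?a \<in> H" if "g \<otimes> ?a \<in> H"
      using convex_positiveD[OF H that] g a leq_mult_left leq_mult_right by blast+
    ultimately have "g \<otimes> ?a \<in> H \<longleftrightarrow> g \<in> H \<and> ?a \<in> H"
      using subgroup.m_closed by metis
    then show ?thesis using g(3)[OF H] convex_mem_iff[OF H x] by blast
  qed
  moreover have "\<one> \<preceq> g \<otimes> ?a" using g a one_leq_mult by blast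
  ultimately show ?case using g(1) a(1) by (intro bexI[of _ "g \<otimes> ?a"]) auto
qed

text \<open>Choose a positive generator \<open>g x\<close> for each x in B and send x, y to the
  image of the subgroup generated by \<open>pos (g x \<otimes> inv (g y))\<close>. The family \<H>
  will be all convex l-subgroups or all l-ideals; \<open>sep\<close> ensures that orthogonal
  elements generate members meeting only in the unit.\<close>

lemma cevian_image:
  assumes conv: "\<And>H. H \<in> \<H> \<Longrightarrow> convex_l_subgroup H G"
    and sep: "\<And>u v. u \<in> carrier G \<Longrightarrow> v \<in> carrier G \<Longrightarrow> \<one> \<preceq> u \<Longrightarrow> \<one> \<preceq> v \<Longrightarrow> orth u v \<Longrightarrow>
      \<exists>H\<in>\<H>. u \<in> H \<and> (\<forall>x\<in>H. \<exists>K\<in>\<H>. v \<in> K \<and> (x \<in> K \<longrightarrow> x = \<one>))"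
    and L: "L = \<lparr>carrier = {\<Inter> {H \<in> \<H>. X \<subseteq> H} |X. finite X \<and> X \<subseteq> carrier G}, eq = (=), le = (\<subseteq>)\<rparr>"
    and B: "distributive_lattice_zero B"
    and image: "homomorphic_image B L"
  shows "cevian B"
proof -
  obtain h where h: "h \<in> carrier L \<rightarrow> carrier B" "join_pres L B h" "meet_pres L B h"
      "h ` carrier L = carrier B"
    using image unfolding homomorphic_image_def lattice_hom_def by blast
  interpret L: Lattice.lattice L using h(2) by (simp add: join_pres_def)
  interpret B: distributive_lattice_zero B by (rule B)
  have iso: "h X \<sqsubseteq>\<^bsub>B\<^esub> h Y" if "X \<in> carrier L" "Y \<in> carrier L" "X \<sqsubseteq>\<^bsub>L\<^esub> Y" for X Y
    using join_pres_isotone[OF h(1,2)] that by (simp add: isotone_def)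
  define gen where "gen g = \<Inter> {H \<in> \<H>. g \<in> H}" for g
  have gen_L: "gen g \<in> carrier L" if "g \<in> carrier G" for g
    using that by (auto simp: L gen_def intro!: exI[of _ "{g}"])
  have L_le: "X \<sqsubseteq>\<^bsub>L\<^esub> Y \<longleftrightarrow> X \<subseteq> Y" for X Y by (simp add: L)
  have gen_self: "g \<in> gen g" for g by (auto simp: gen_def)
  have L_elem: "\<exists>g\<in>carrier G. \<one> \<preceq> g \<and> X = gen g" if X: "X \<in> carrier L" for X
  proof -
    obtain Y where Y: "finite Y" "Y \<subseteq> carrier G" "X = \<Inter> {H \<in> \<H>. Y \<subseteq> H}"
      using X by (auto simp: L)
    then obtain g where g: "g \<in> carrier G" "\<one> \<preceq> g"
        "\<And>H. convex_l_subgroup H G \<Longrightarrow> Y \<subseteq> H \<longleftrightarrow> g \<in> H"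
      using principal by blast
    then have "{H \<in> \<H>. Y \<subseteq> H} = {H \<in> \<H>. g \<in> H}" using conv by blast
    then show ?thesis using g Y(3) by (auto simp: gen_def)
  qed
  \<comment> \<open>The join in L is itself some \<open>gen g\<close>. Every member of \<H> that
    contains g contains u and v, hence w.\<close>
  have le_join: "gen w \<sqsubseteq>\<^bsub>L\<^esub> gen u \<squnion>\<^bsub>L\<^esub> gen v"
    if "w \<in> carrier G" "u \<in> carrier G" "v \<in> carrier G"
      and mem: "\<And>H. H \<in> \<H> \<Longrightarrow> u \<in> H \<Longrightarrow> v \<in> H \<Longrightarrow> w \<in> H" for u v w
  proof -
    let ?J = "gen u \<squnion>\<^bsub>L\<^esub> gen v"
    have "?J \<in> carrier L" using gen_L that by simp
    then obtain g where g: "?J = gen g" using L_elem by blast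
    have "u \<in> ?J" "v \<in> ?J"
      using L.join_left[OF gen_L gen_L, of u v] L.join_right[OF gen_L gen_L, of u v] that gen_self
      by (auto simp: L_le)
    then have "\<And>H. H \<in> \<H> \<Longrightarrow> g \<in> H \<Longrightarrow> w \<in> H" unfolding g using mem by (auto simp: gen_def)
    then show ?thesis unfolding g L_le by (auto simp: gen_def)
  qed
  have meet: "gen u \<sqinter>\<^bsub>L\<^esub> gen v \<sqsubseteq>\<^bsub>L\<^esub> X"
    if uv: "u \<in> carrier G" "v \<in> carrier G" "\<one> \<preceq> u" "\<one> \<preceq> v" "orth u v" and X: "X \<in> carrier L" for u v X
  proof -
    obtain H where H: "H \<in> \<H>" "u \<in> H" "\<And>x. x \<in> H \<Longrightarrow> \<exists>K\<in>\<H>. v \<in> K \<and> (x \<in> K \<longrightarrow> x = \<one>)"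
      using sep[OF uv] by blast
    have "gen u \<sqinter>\<^bsub>L\<^esub> gen v \<subseteq> gen u \<inter> gen v"
      using L.meet_left[OF gen_L gen_L, of u v] L.meet_right[OF gen_L gen_L, of u v] uv
      by (auto simp: L_le)
    also have "\<dots> \<subseteq> {\<one>}"
    proof
      fix x assume x: "x \<in> gen u \<inter> gen v"
      then have "x \<in> H" using H(1,2) by (auto simp: gen_def)
      then obtain K where "K \<in> \<H>" "v \<in> K" "x \<in> K \<longrightarrow> x = \<one>" using H(3) by blast
      then show "x \<in> {\<one>}" using x by (auto simp: gen_def)
    qed
    also have "\<dots> \<subseteq> X"
      using L_elem[OF X] convex_one[OF conv] by (auto simp: gen_def)
    finally show ?thesis by (simp add: L_le)
  qed
  have "\<forall>x\<in>carrier B. \<exists>g\<in>carrier G. \<one> \<preceq> g \<and> h (gen g) = x"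
    using h(4) L_elem by (metis imageE)
  then obtain g where g: "\<And>x. x \<in> carrier B \<Longrightarrow> g x \<in> carrier G"
      "\<And>x. x \<in> carrier B \<Longrightarrow> \<one> \<preceq> g x" "\<And>x. x \<in> carrier B \<Longrightarrow> h (gen (g x)) = x"
    by metis
  define p where "p x y = pos (g x \<otimes> inv (g y))" for x y
  have p: "p x y \<in> carrier G" if "x \<in> carrier B" "y \<in> carrier B" for x y
    using that g(1) by (simp add: p_def pos_closed)
  have p1: "\<one> \<preceq> p x y" if "x \<in> carrier B" "y \<in> carrier B" for x y
    using that g(1) by (simp add: p_def one_leq_pos)
  have h_join: "h (X \<squnion>\<^bsub>L\<^esub> Y) = h X \<squnion>\<^bsub>B\<^esub> h Y" if "X \<in> carrier L" "Y \<in> carrier L" for X Y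
    using h(2) that by (simp add: join_pres_def)
  have h_meet: "h (X \<sqinter>\<^bsub>L\<^esub> Y) = h X \<sqinter>\<^bsub>B\<^esub> h Y" if "X \<in> carrier L" "Y \<in> carrier L" for X Y
    using h(3) that by (simp add: meet_pres_def)
  define d where "d x y = h (gen (p x y))" for x y
  have sub: "subgroup H G" if "H \<in> \<H>" for H using convex_subgroup conv that by blast
  have "cevian_operation B d"
    unfolding cevian_operation_def
  proof (intro conjI ballI)
    fix x y assume xy: "x \<in> carrier B" "y \<in> carrier B"
    show "d x y \<in> carrier B" using h(1) gen_L p[OF xy] by (auto simp: d_def)
    have le: "g x \<preceq> p x y \<otimes> g y"
    proof -
      have "g x \<otimes> inv (g y) \<otimes> g y \<preceq> p x y \<otimes> g y"
        unfolding p_def using xy g(1) by (intro mult_right_mono leq_pos) (auto simp: pos_closed)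
      then show ?thesis using xy g(1) by (simp add: m_assoc)
    qed
    have "gen (g x) \<sqsubseteq>\<^bsub>L\<^esub> gen (g y) \<squnion>\<^bsub>L\<^esub> gen (p x y)"
    proof (rule le_join)
      fix H assume H: "H \<in> \<H>" "g y \<in> H" "p x y \<in> H"
      then have "p x y \<otimes> g y \<in> H" using sub subgroup.m_closed by metis
      then show "g x \<in> H" using convex_positiveD[OF conv[OF H(1)] _ g(2) le] xy g(1) by blast
    qed (use xy g p in auto)
    then have "h (gen (g x)) \<sqsubseteq>\<^bsub>B\<^esub> h (gen (g y) \<squnion>\<^bsub>L\<^esub> gen (p x y))"
      using xy g p gen_L by (intro iso) auto
    then show "x \<sqsubseteq>\<^bsub>B\<^esub> y \<squnion>\<^bsub>B\<^esub> d x y"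
      using xy g p gen_L by (simp add: h_join d_def)
    have "p y x = pos (inv (g x \<otimes> inv (g y)))"
      using xy g(1) by (simp add: p_def inv_mult_group)
    then have orth: "orth (p x y) (p y x)"
      using orth_pos_inv[of "g x \<otimes> inv (g y)"] xy g(1) by (simp add: p_def)
    let ?M = "gen (p x y) \<sqinter>\<^bsub>L\<^esub> gen (p y x)"
    have M: "?M \<in> carrier L" using xy gen_L p by simp
    \<comment> \<open>A lattice homomorphism need not preserve the bottom. Here \<open>?M\<close> is
      below every element of L and h is onto, so its image is least in B.\<close>
    have "h ?M \<sqsubseteq>\<^bsub>B\<^esub> z" if "z \<in> carrier B" for z
      using iso[OF M gen_L[OF g(1)[OF that]] meet[OF p p p1 p1 orth gen_L[OF g(1)[OF that]]]]
        xy g(3)[OF that] by simp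
    moreover have "h ?M \<in> carrier B" using M h(1) by blast
    ultimately have "h ?M = \<bottom>\<^bsub>B\<^esub>" using B.le_antisym B.bottom_closed B.bottom_lower by blast
    then show "d x y \<sqinter>\<^bsub>B\<^esub> d y x = \<bottom>\<^bsub>B\<^esub>"
      using xy gen_L p by (simp add: h_meet d_def)
  next
    fix x y z assume xyz: "x \<in> carrier B" "y \<in> carrier B" "z \<in> carrier B"
    have "(g x \<otimes> inv (g y)) \<otimes> (g y \<otimes> inv (g z)) = g x \<otimes> inv (g z)"
      using xyz g(1) by (simp add: m_assoc inv_solve_left' flip: m_assoc[of "inv (g y)" "g y"])
    then have le: "p x z \<preceq> p x y \<otimes> p y z"
      using pos_mult[of "g x \<otimes> inv (g y)" "g y \<otimes> inv (g z)"] xyz g(1) by (simp add: p_def)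
    have "gen (p x z) \<sqsubseteq>\<^bsub>L\<^esub> gen (p x y) \<squnion>\<^bsub>L\<^esub> gen (p y z)"
    proof (rule le_join)
      fix H assume H: "H \<in> \<H>" "p x y \<in> H" "p y z \<in> H"
      then have "p x y \<otimes> p y z \<in> H" using sub subgroup.m_closed by metis
      then show "p x z \<in> H" using convex_positiveD[OF conv[OF H(1)] _ p1 le] xyz p by blast
    qed (use xyz p in auto)
    then have "h (gen (p x z)) \<sqsubseteq>\<^bsub>B\<^esub> h (gen (p x y) \<squnion>\<^bsub>L\<^esub> gen (p y z))"
      using xyz p gen_L by (intro iso) auto
    then show "d x z \<sqsubseteq>\<^bsub>B\<^esub> d x y \<squnion>\<^bsub>B\<^esub> d y z"
      using xyz p gen_L by (simp add: h_join d_def)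
  qed
  then show ?thesis using B by (auto simp: cevian_def)
qed

section \<open>Polars\<close>

definition polar where
  "polar v = {x \<in> carrier G. orth (pos x) v \<and> orth (pos (inv x)) v}"

text \<open>Bounds orthogonal to v replace the exact positive parts, which would be awkward to
  compute for products, joins and meets.\<close>

lemma polarI:
  assumes "x \<in> carrier G" "a \<in> carrier G" "b \<in> carrier G" "x \<preceq> a" "\<one> \<preceq> a" "orth a v"
    "inv x \<preceq> b" "\<one> \<preceq> b" "orth b v"
  shows "x \<in> polar v"
  unfolding polar_def
  using orth_mono[OF assms(6) pos_least[OF assms(4,5)]] orth_mono[OF assms(9) pos_least[OF assms(7,8)]]
  by (simp add: assms(1-3) pos_closed)

text \<open>Products of positive parts stay orthogonal to v by \<open>orth_mult\<close> and bound
  products and joins; those of the inverses bound inverses of products and meets. Convexity uses the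
  bounds of the endpoints.\<close>

lemma convex_polar:
  assumes v: "v \<in> carrier G"
  shows "convex_l_subgroup (polar v) G"
proof -
  have mem: "x \<in> carrier G" "orth (pos x) v" "orth (pos (inv x)) v" if "x \<in> polar v" for x
    using that by (auto simp: polar_def)
  note c = pos_closed m_closed inv_closed one_leq_pos one_leq_mult orth_mult v mem
    join_closed meet_closed
  have prod: "orth (pos x \<otimes> pos y) v" "orth (pos (inv x) \<otimes> pos (inv y)) v"
    if "x \<in> polar v" "y \<in> polar v" for x y
    using that by (auto intro!: orth_mult simp: c)
  have x_le: "x \<preceq> pos x \<otimes> pos y" "y \<preceq> pos x \<otimes> pos y" if "x \<in> carrier G" "y \<in> carrier G" for x y
    using that leq_trans[OF leq_pos leq_mult_right[OF one_leq_pos]]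
      leq_trans[OF leq_pos leq_mult_left[OF one_leq_pos]] by (simp_all add: pos_closed)
  have sub: "subgroup (polar v) G"
  proof
    show "polar v \<subseteq> carrier G" by (auto simp: polar_def)
    show "\<one> \<in> polar v" by (rule polarI[of _ \<one> \<one>]) (auto simp: leq_refl orth_one)
    show "inv x \<in> polar v" if "x \<in> polar v" for x using that by (auto simp: polar_def)
    fix x y assume xy: "x \<in> polar v" "y \<in> polar v"
    show "x \<otimes> y \<in> polar v"
    proof (rule polarI[of _ "pos x \<otimes> pos y" "pos (inv y) \<otimes> pos (inv x)"])
      show "x \<otimes> y \<preceq> pos x \<otimes> pos y"
        using xy by (intro mult_mono leq_pos) (auto simp: c)
      show "inv (x \<otimes> y) \<preceq> pos (inv y) \<otimes> pos (inv x)"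
        using xy by (simp add: inv_mult_group c) (intro mult_mono leq_pos; simp add: c)
    qed (use xy prod in \<open>auto simp: c\<close>)
  qed
  show ?thesis
    unfolding convex_l_subgroup_def
  proof (intro conjI sub ballI impI)
    fix x y assume xy: "x \<in> polar v" "y \<in> polar v"
    show "x \<squnion>\<^bsub>Ord\<^esub> y \<in> polar v"
    proof (rule polarI[of _ "pos x \<otimes> pos y" "pos (inv x)"])
      show "x \<squnion>\<^bsub>Ord\<^esub> y \<preceq> pos x \<otimes> pos y" using xy by (intro join_least x_le) (auto simp: c)
      show "inv (x \<squnion>\<^bsub>Ord\<^esub> y) \<preceq> pos (inv x)"
        using xy leq_trans[OF inv_anti[OF join_left] leq_pos, of x y] by (simp add: c)
    qed (use xy prod in \<open>auto simp: c\<close>)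
    show "x \<sqinter>\<^bsub>Ord\<^esub> y \<in> polar v"
    proof (rule polarI[of _ "pos x" "pos (inv x) \<otimes> pos (inv y)"])
      let ?c = "pos (inv x) \<otimes> pos (inv y)"
      show "x \<sqinter>\<^bsub>Ord\<^esub> y \<preceq> pos x"
        using xy leq_trans[OF meet_left leq_pos, of x y] by (simp add: c)
      have "inv ?c \<preceq> inv (inv x)" "inv ?c \<preceq> inv (inv y)"
        using xy by (intro inv_anti x_le; simp add: c)+
      then have "inv ?c \<preceq> x \<sqinter>\<^bsub>Ord\<^esub> y" using xy by (intro meet_greatest) (auto simp: c)
      then have "inv (x \<sqinter>\<^bsub>Ord\<^esub> y) \<preceq> inv (inv ?c)" using xy by (intro inv_anti) (auto simp: c)
      then show "inv (x \<sqinter>\<^bsub>Ord\<^esub> y) \<preceq> ?c" using xy by (simp add: c)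
    qed (use xy prod in \<open>auto simp: c\<close>)
  next
    fix x z y assume x: "x \<in> polar v" and z: "z \<in> polar v" and y: "y \<in> carrier G" "x \<preceq> y \<and> y \<preceq> z"
    show "y \<in> polar v"
    proof (rule polarI[of _ "pos z" "pos (inv x)"])
      show "y \<preceq> pos z" using x y z leq_trans[OF _ leq_pos, of y z] by (simp add: c)
      show "inv y \<preceq> pos (inv x)"
        using x y z leq_trans[OF inv_anti leq_pos, of x y] by (simp add: c)
    qed (use x y z in \<open>auto simp: c\<close>)
  qed
qed

lemma mem_polar: "u \<in> carrier G \<Longrightarrow> \<one> \<preceq> u \<Longrightarrow> orth u v \<Longrightarrow> u \<in> polar v"
  using inv_anti[of \<one> u] by (intro polarI[of _ u \<one>]) (auto simp: leq_refl orth_one)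

text \<open>The polar of v contains u. An x in it has absolute value orthogonal to v, so v lies in
  the polar of that value, and x belongs to the latter only if it is the unit.\<close>

theorem cevian_image_Cs_c:
  assumes "distributive_lattice_zero B" "homomorphic_image B (Cs_c G)"
  shows "cevian B"
proof (rule cevian_image[OF _ _ _ assms])
  show "Cs_c G = \<lparr>carrier = {\<Inter> {H \<in> {H. convex_l_subgroup H G}. X \<subseteq> H} |X. finite X \<and> X \<subseteq> carrier G},
      eq = (=), le = (\<subseteq>)\<rparr>"
    by (simp add: Cs_c_def convex_l_subgroup_generated_def)
  fix u v assume uv: "u \<in> carrier G" "v \<in> carrier G" "\<one> \<preceq> u" "\<one> \<preceq> v" "orth u v"
  show "\<exists>H\<in>{H. convex_l_subgroup H G}. u \<in> H \<and>
      (\<forall>x\<in>H. \<exists>K\<in>{H. convex_l_subgroup H G}. v \<in> K \<and> (x \<in> K \<longrightarrow> x = \<one>))"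
  proof (rule bexI[of _ "polar v"], intro conjI ballI)
    show "u \<in> polar v" using mem_polar uv by blast
    show "polar v \<in> {H. convex_l_subgroup H G}" using convex_polar uv by blast
    fix x assume "x \<in> polar v"
    then have x: "x \<in> carrier G" "orth (pos x) v" "orth (pos (inv x)) v" by (auto simp: polar_def)
    let ?a = "pos x \<otimes> pos (inv x)"
    have a: "?a \<in> carrier G" using x by (simp add: pos_closed)
    show "\<exists>K\<in>{H. convex_l_subgroup H G}. v \<in> K \<and> (x \<in> K \<longrightarrow> x = \<one>)"
    proof (rule bexI[of _ "polar ?a"], intro conjI impI)
      show "polar ?a \<in> {H. convex_l_subgroup H G}" using convex_polar a by blast
      have "orth ?a v" using x uv by (intro orth_mult) (auto simp: pos_closed one_leq_pos)
      then show "v \<in> polar ?a" using mem_polar orth_sym uv by blast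
      assume "x \<in> polar ?a"
      then have "orth (pos x) ?a" "orth (pos (inv x)) ?a" by (auto simp: polar_def)
      \<comment> \<open>Each of the two parts is below both itself and \<open>?a\<close>, so
        orthogonality bounds it by the unit.\<close>
      then have "pos x \<preceq> \<one>" "pos (inv x) \<preceq> \<one>"
        using x unfolding orth_def
        by (auto simp: pos_closed leq_refl one_leq_pos leq_mult_left leq_mult_right)
      then have "x \<preceq> \<one>" "inv x \<preceq> \<one>"
        using x leq_trans[OF leq_pos, of x \<one>] leq_trans[OF leq_pos, of "inv x" \<one>]
        by (simp_all add: pos_closed)
      then show "x = \<one>" using x leq_antisym[of x \<one>] inv_anti[of "inv x" \<one>] by simp
    qed
  qed
qed simp

end

section \<open>Representable l-groups\<close>

text \<open>Joins and meets in a product of totally ordered groups are coordinatewise maxima and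
  minima, so each coordinate selects one of the two arguments.\<close>

lemma representable_total_coordinates:
  fixes G :: "'a lgroup"
  assumes "representable G"
  obtains I and T :: "'a set \<Rightarrow> 'a set lgroup" and e where
    "\<And>i. i \<in> I \<Longrightarrow> group (T i)" "\<And>i. i \<in> I \<Longrightarrow> (\<lambda>x. e x i) \<in> hom G (T i)"
    "\<And>i x y. i \<in> I \<Longrightarrow> x \<in> carrier G \<Longrightarrow> y \<in> carrier G \<Longrightarrow> x \<preceq>\<^bsub>G\<^esub> y \<Longrightarrow> e x i \<preceq>\<^bsub>T i\<^esub> e y i"
    "\<And>i x y. i \<in> I \<Longrightarrow> x \<in> carrier (T i) \<Longrightarrow> y \<in> carrier (T i) \<Longrightarrow> x \<preceq>\<^bsub>T i\<^esub> y \<Longrightarrow> y \<preceq>\<^bsub>T i\<^esub> x \<Longrightarrow> x = y"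
    "\<And>x y. x \<in> carrier G \<Longrightarrow> y \<in> carrier G \<Longrightarrow> (\<And>i. i \<in> I \<Longrightarrow> e x i = e y i) \<Longrightarrow> x = y"
    "\<And>i x y. i \<in> I \<Longrightarrow> x \<in> carrier G \<Longrightarrow> y \<in> carrier G \<Longrightarrow>
      e (x \<squnion>\<^bsub>order_of G\<^esub> y) i = e x i \<or> e (x \<squnion>\<^bsub>order_of G\<^esub> y) i = e y i"
    "\<And>i x y. i \<in> I \<Longrightarrow> x \<in> carrier G \<Longrightarrow> y \<in> carrier G \<Longrightarrow>
      e (x \<sqinter>\<^bsub>order_of G\<^esub> y) i = e x i \<or> e (x \<sqinter>\<^bsub>order_of G\<^esub> y) i = e y i"
proof -
  obtain I and T :: "'a set \<Rightarrow> 'a set lgroup"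
    where "\<forall>i\<in>I. totally_ordered_group (T i)" and sd: "subdirect_product G I T"
    using assms unfolding representable_def by (elim conjE exE) (rule that; assumption)
  then have T: "totally_ordered_group (T i)" if "i \<in> I" for i using that by simp
  let ?P = "product_lgroup I T"
  obtain e where e: "l_group_hom G ?P e" "inj_on e (carrier G)"
    using sd unfolding subdirect_product_def by (elim exE conjE) (rule that; assumption)
  have hom: "e \<in> hom G ?P" and pres: "join_pres (order_of G) (order_of ?P) e"
      "meet_pres (order_of G) (order_of ?P) e"
    using e(1) by (auto simp: l_group_hom_def lattice_hom_def)
  have carP: "carrier ?P = (\<Pi>\<^sub>E i\<in>I. carrier (T i))" by (simp add: product_lgroup_def)
  have e_P: "e x \<in> carrier ?P" if "x \<in> carrier G" for x using hom that by (auto simp: hom_def)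
  have e_T: "e x i \<in> carrier (T i)" if "x \<in> carrier G" "i \<in> I" for x i
    using e_P[OF that(1)] that(2) by (auto simp: carP)
  interpret P: Lattice.lattice "order_of ?P" using pres(1) by (simp add: join_pres_def)
  have P: "carrier (order_of ?P) = carrier ?P" "le (order_of ?P) x y \<longleftrightarrow> (\<forall>i\<in>I. x i \<preceq>\<^bsub>T i\<^esub> y i)" for x y
    by (simp_all add: order_of_def product_lgroup_def)
  have tot: "total_order (order_of (T i))" if "i \<in> I" for i
    using T[OF that] by (simp add: totally_ordered_group_def)
  have total: "x \<preceq>\<^bsub>T i\<^esub> y \<or> y \<preceq>\<^bsub>T i\<^esub> x"
    if "i \<in> I" "x \<in> carrier (T i)" "y \<in> carrier (T i)" for i x y
    using total_order.total_order_total[OF tot[OF that(1)], of x y] that by (simp add: order_of_def)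
  have antisym: "x = y"
    if "i \<in> I" "x \<in> carrier (T i)" "y \<in> carrier (T i)" "x \<preceq>\<^bsub>T i\<^esub> y" "y \<preceq>\<^bsub>T i\<^esub> x" for i x y
  proof -
    interpret total_order "order_of (T i)" by (rule tot[OF that(1)])
    show ?thesis using le_antisym[of x y] that by (simp add: order_of_def)
  qed
  have refl: "x \<preceq>\<^bsub>T i\<^esub> x" if "i \<in> I" "x \<in> carrier (T i)" for i x using total that by blast
  show thesis
  proof (rule that[of I T e])
    fix i assume i: "i \<in> I"
    show "group (T i)"
      using T[OF i] by (simp add: totally_ordered_group_def l_group_def)
    show "(\<lambda>x. e x i) \<in> hom G (T i)"
      using hom i e_T by (auto simp: hom_def product_lgroup_def)
    fix x y
    show "x \<in> carrier (T i) \<Longrightarrow> y \<in> carrier (T i) \<Longrightarrow> x \<preceq>\<^bsub>T i\<^esub> y \<Longrightarrow> y \<preceq>\<^bsub>T i\<^esub> x \<Longrightarrow> x = y"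
      using antisym i by blast
  next
    fix i x y assume i: "i \<in> I" and xy: "x \<in> carrier G" "y \<in> carrier G"
    show "x \<preceq>\<^bsub>G\<^esub> y \<Longrightarrow> e x i \<preceq>\<^bsub>T i\<^esub> e y i"
      using join_pres_isotone[OF _ pres(1)] e_P xy i unfolding isotone_def
      by (auto simp: P(1)[symmetric]) (auto simp: order_of_def product_lgroup_def)
    \<comment> \<open>These are the coordinatewise maximum and minimum, restricted to
      \<open>I\<close> because elements of the product are extensional.\<close>
    let ?M = "\<lambda>j\<in>I. if e x j \<preceq>\<^bsub>T j\<^esub> e y j then e y j else e x j"
      and ?m = "\<lambda>j\<in>I. if e x j \<preceq>\<^bsub>T j\<^esub> e y j then e x j else e y j"
    have Mm: "?M \<in> carrier ?P" "?m \<in> carrier ?P" using e_T xy by (auto simp: carP)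
    have cmp: "e y j \<preceq>\<^bsub>T j\<^esub> e x j" if "j \<in> I" "\<not> e x j \<preceq>\<^bsub>T j\<^esub> e y j" for j
      using total[OF that(1)] e_T xy that by blast
    have J: "e (x \<squnion>\<^bsub>order_of G\<^esub> y) = e x \<squnion>\<^bsub>order_of ?P\<^esub> e y"
      using pres(1) xy by (simp add: join_pres_def order_of_def)
    have K: "e (x \<sqinter>\<^bsub>order_of G\<^esub> y) = e x \<sqinter>\<^bsub>order_of ?P\<^esub> e y"
      using pres(2) xy by (simp add: meet_pres_def order_of_def)
    have J_P: "e x \<squnion>\<^bsub>order_of ?P\<^esub> e y \<in> carrier ?P" and K_P: "e x \<sqinter>\<^bsub>order_of ?P\<^esub> e y \<in> carrier ?P"
      using P.join_closed[of "e x" "e y"] P.meet_closed[of "e x" "e y"] e_P xy by (simp_all add: P(1))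
    have "e x \<squnion>\<^bsub>order_of ?P\<^esub> e y \<sqsubseteq>\<^bsub>order_of ?P\<^esub> ?M"
      by (rule P.join_le) (use e_P xy Mm cmp refl e_T in \<open>auto simp: P\<close>)
    then have "(e x \<squnion>\<^bsub>order_of ?P\<^esub> e y) i \<preceq>\<^bsub>T i\<^esub> ?M i" using i unfolding P(2) by blast
    moreover have "?M i \<preceq>\<^bsub>T i\<^esub> (e x \<squnion>\<^bsub>order_of ?P\<^esub> e y) i"
      using P.join_left[of "e x" "e y"] P.join_right[of "e x" "e y"] e_P xy i
      by (auto simp: P)
    ultimately have "e (x \<squnion>\<^bsub>order_of G\<^esub> y) i = ?M i"
      unfolding J using antisym[OF i] Mm(1) J_P i unfolding carP by blast
    then show "e (x \<squnion>\<^bsub>order_of G\<^esub> y) i = e x i \<or> e (x \<squnion>\<^bsub>order_of G\<^esub> y) i = e y i"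
      using i by simp
    have "?m \<sqsubseteq>\<^bsub>order_of ?P\<^esub> e x \<sqinter>\<^bsub>order_of ?P\<^esub> e y"
      by (rule P.meet_le) (use e_P xy Mm cmp refl e_T in \<open>auto simp: P\<close>)
    then have "?m i \<preceq>\<^bsub>T i\<^esub> (e x \<sqinter>\<^bsub>order_of ?P\<^esub> e y) i" using i unfolding P(2) by blast
    moreover have "(e x \<sqinter>\<^bsub>order_of ?P\<^esub> e y) i \<preceq>\<^bsub>T i\<^esub> ?m i"
      using P.meet_left[of "e x" "e y"] P.meet_right[of "e x" "e y"] e_P xy i
      by (auto simp: P)
    ultimately have "e (x \<sqinter>\<^bsub>order_of G\<^esub> y) i = ?m i"
      unfolding K using antisym[OF i] Mm(2) K_P i unfolding carP by blast
    then show "e (x \<sqinter>\<^bsub>order_of G\<^esub> y) i = e x i \<or> e (x \<sqinter>\<^bsub>order_of G\<^esub> y) i = e y i"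
      using i by simp
  next
    fix x y assume xy: "x \<in> carrier G" "y \<in> carrier G" and eq: "\<And>i. i \<in> I \<Longrightarrow> e x i = e y i"
    have "e x = e y" using e_P[OF xy(1)] e_P[OF xy(2)] eq unfolding carP by (rule PiE_ext)
    then show "x = y" using e(2) xy by (simp add: inj_on_eq_iff)
  qed
qed

text \<open>Each totally ordered coordinate kills one of two orthogonal positive elements u and v.
  The elements trivial wherever u is trivial, and those trivial wherever v is, form two l-ideals
  that contain u and v respectively and meet only in the unit.\<close>

theorem (in l_group) cevian_image_Id_c:
  assumes G: "representable G" and B: "distributive_lattice_zero B" "homomorphic_image B (Id_c G)"
  shows "cevian B"
proof -
  obtain I and T :: "'a set \<Rightarrow> 'a set lgroup" and e where
    T: "\<And>i. i \<in> I \<Longrightarrow> group (T i)" and hom: "\<And>i. i \<in> I \<Longrightarrow> (\<lambda>x. e x i) \<in> hom G (T i)"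
    and mono: "\<And>i x y. i \<in> I \<Longrightarrow> x \<in> carrier G \<Longrightarrow> y \<in> carrier G \<Longrightarrow> x \<preceq>\<^bsub>G\<^esub> y \<Longrightarrow> e x i \<preceq>\<^bsub>T i\<^esub> e y i"
    and antisym: "\<And>i x y. i \<in> I \<Longrightarrow> x \<in> carrier (T i) \<Longrightarrow> y \<in> carrier (T i) \<Longrightarrow> x \<preceq>\<^bsub>T i\<^esub> y \<Longrightarrow>
      y \<preceq>\<^bsub>T i\<^esub> x \<Longrightarrow> x = y"
    and inj: "\<And>x y. x \<in> carrier G \<Longrightarrow> y \<in> carrier G \<Longrightarrow> (\<And>i. i \<in> I \<Longrightarrow> e x i = e y i) \<Longrightarrow> x = y"
    and join: "\<And>i x y. i \<in> I \<Longrightarrow> x \<in> carrier G \<Longrightarrow> y \<in> carrier G \<Longrightarrow>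
      e (x \<squnion>\<^bsub>Ord\<^esub> y) i = e x i \<or> e (x \<squnion>\<^bsub>Ord\<^esub> y) i = e y i"
    and meet: "\<And>i x y. i \<in> I \<Longrightarrow> x \<in> carrier G \<Longrightarrow> y \<in> carrier G \<Longrightarrow>
      e (x \<sqinter>\<^bsub>Ord\<^esub> y) i = e x i \<or> e (x \<sqinter>\<^bsub>Ord\<^esub> y) i = e y i"
    using representable_total_coordinates[OF G] by blast
  have gh: "group_hom G (T i) (\<lambda>x. e x i)" if "i \<in> I" for i
    using T[OF that] hom[OF that] by (simp add: group_hom_def group_hom_axioms_def)
  have e_one: "e \<one> i = \<one>\<^bsub>T i\<^esub>" if "i \<in> I" for i
    using group_hom.hom_one[OF gh[OF that]] .
  have e_mult: "e (x \<otimes> y) i = e x i \<otimes>\<^bsub>T i\<^esub> e y i"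
    if "i \<in> I" "x \<in> carrier G" "y \<in> carrier G" for i x y
    using group_hom.hom_mult[OF gh[OF that(1)]] that by blast
  have e_inv: "e (inv x) i = inv\<^bsub>T i\<^esub> (e x i)" if "i \<in> I" "x \<in> carrier G" for i x
    using group_hom.hom_inv[OF gh[OF that(1)]] that by blast
  have e_T: "e x i \<in> carrier (T i)" if "i \<in> I" "x \<in> carrier G" for i x
    using group_hom.hom_closed[OF gh[OF that(1)]] that by blast
  define ker where "ker S = {x \<in> carrier G. \<forall>i\<in>S. e x i = \<one>\<^bsub>T i\<^esub>}" for S
  have ideal: "l_ideal (ker S) G" if S: "S \<subseteq> I" for S
  proof -
    note SI = subsetD[OF S]
    have one_mult: "\<one>\<^bsub>T i\<^esub> \<otimes>\<^bsub>T i\<^esub> \<one>\<^bsub>T i\<^esub> = \<one>\<^bsub>T i\<^esub>" "inv\<^bsub>T i\<^esub> \<one>\<^bsub>T i\<^esub> = \<one>\<^bsub>T i\<^esub>" if "i \<in> I" for i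
      using T[OF that] by (simp_all add: group.is_monoid monoid.r_one monoid.one_closed monoid.inv_one)
    have sub: "subgroup (ker S) G"
      by unfold_locales (auto simp: ker_def e_one e_mult e_inv one_mult SI)
    have "x \<otimes> y \<otimes> inv x \<in> ker S" if x: "x \<in> carrier G" and y: "y \<in> ker S" for x y
    proof -
      have "e (x \<otimes> y \<otimes> inv x) i = \<one>\<^bsub>T i\<^esub>" if i: "i \<in> S" for i
      proof -
        interpret Ti: group "T i" using T SI i by blast
        show ?thesis using x y i e_T[OF SI[OF i] x] by (simp add: ker_def e_mult e_inv SI)
      qed
      then show ?thesis using x y by (simp add: ker_def)
    qed
    then have "ker S \<lhd> G" using sub by (simp add: normal_inv_iff)
    moreover have "convex_l_subgroup (ker S) G"
      unfolding convex_l_subgroup_def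
    proof (intro conjI sub ballI impI)
      fix x y assume xy: "x \<in> ker S" "y \<in> ker S"
      show "x \<squnion>\<^bsub>Ord\<^esub> y \<in> ker S" "x \<sqinter>\<^bsub>Ord\<^esub> y \<in> ker S"
        using xy join[OF SI, of _ x y] meet[OF SI, of _ x y]
        by (auto simp: ker_def join_closed meet_closed)
    next
      fix x z y assume xz: "x \<in> ker S" "z \<in> ker S" and y: "y \<in> carrier G" "x \<preceq> y \<and> y \<preceq> z"
      have "e y i = \<one>\<^bsub>T i\<^esub>" if i: "i \<in> S" for i
        using antisym[OF SI[OF i], of "e y i" "e x i"] mono[OF SI[OF i], of x y]
          mono[OF SI[OF i], of y z] xz y i e_T[OF SI[OF i]]
          monoid.one_closed[OF group.is_monoid[OF T[OF SI[OF i]]]] by (simp add: ker_def)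
      then show "y \<in> ker S" using y by (simp add: ker_def)
    qed
    ultimately show ?thesis by (simp add: l_ideal_def)
  qed
  show ?thesis
  proof (rule cevian_image[OF _ _ _ B])
    show "Id_c G = \<lparr>carrier = {\<Inter> {H \<in> {H. l_ideal H G}. X \<subseteq> H} |X. finite X \<and> X \<subseteq> carrier G},
        eq = (=), le = (\<subseteq>)\<rparr>"
      by (simp add: Id_c_def l_ideal_generated_def)
    show "convex_l_subgroup H G" if "H \<in> {H. l_ideal H G}" for H
      using that by (simp add: l_ideal_def)
    fix u v assume uv: "u \<in> carrier G" "v \<in> carrier G" "\<one> \<preceq> u" "\<one> \<preceq> v" "orth u v"
    have "u \<sqinter>\<^bsub>Ord\<^esub> v \<preceq> \<one>"
      using uv(5) by (simp add: orth_def meet_left meet_right meet_closed uv(1,2))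
    then have "u \<sqinter>\<^bsub>Ord\<^esub> v = \<one>"
      by (intro leq_antisym meet_greatest meet_closed one_closed uv)
    \<comment> \<open>Each coordinate of the meet is that of u or of v, and the meet is the
      unit.\<close>
    then have cover: "e u i = \<one>\<^bsub>T i\<^esub> \<or> e v i = \<one>\<^bsub>T i\<^esub>" if "i \<in> I" for i
      using meet[OF that uv(1,2)] e_one[OF that] by auto
    define S where "S w = {i \<in> I. e w i = \<one>\<^bsub>T i\<^esub>}" for w
    have mem: "w \<in> ker (S w)" if "w \<in> carrier G" for w using that by (simp add: ker_def S_def)
    have lid: "ker (S w) \<in> {H. l_ideal H G}" for w using ideal[of "S w"] by (auto simp: S_def)
    show "\<exists>H\<in>{H. l_ideal H G}. u \<in> H \<and>
        (\<forall>x\<in>H. \<exists>K\<in>{H. l_ideal H G}. v \<in> K \<and> (x \<in> K \<longrightarrow> x = \<one>))"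
    proof (rule bexI[OF _ lid[of u]], intro conjI ballI mem uv)
      fix x assume x: "x \<in> ker (S u)"
      show "\<exists>K\<in>{H. l_ideal H G}. v \<in> K \<and> (x \<in> K \<longrightarrow> x = \<one>)"
      proof (rule bexI[OF _ lid[of v]], intro conjI impI mem uv)
        assume "x \<in> ker (S v)"
        then have "e x i = e \<one> i" if "i \<in> I" for i
          using x cover[OF that] that by (auto simp: ker_def S_def e_one)
        then show "x = \<one>" using inj[of x \<one>] x by (simp add: ker_def)
      qed
    qed
  qed
qed

theorem corollary7p3:
  shows "(\<exists>B' :: nat set set gorder.
            bounded_lattice B' \<and> completely_normal B' \<and> countably_based_differences B' \<and>
            has_card_aleph2 (carrier B') \<and> \<not> cevian B') \<and>
         (\<forall>B' :: nat set set gorder.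
            bounded_lattice B' \<and> completely_normal B' \<and> countably_based_differences B' \<and>
            has_card_aleph2 (carrier B') \<and> \<not> cevian B' \<longrightarrow>
              (\<forall>G :: 'g lgroup. l_group G \<longrightarrow> \<not> homomorphic_image B' (Cs_c G)) \<and>
              (\<forall>G :: 'g lgroup. representable G \<longrightarrow> \<not> homomorphic_image B' (Id_c G)))"
proof (intro conjI allI impI)
  show "\<exists>B' :: nat set set gorder.
      bounded_lattice B' \<and> completely_normal B' \<and> countably_based_differences B' \<and>
      has_card_aleph2 (carrier B') \<and> \<not> cevian B'"
    by (rule exists_non_cevian)
next
  fix B' :: "nat set set gorder" and G :: "'g lgroup"
  assume "bounded_lattice B' \<and> completely_normal B' \<and> countably_based_differences B' \<and>
    has_card_aleph2 (carrier B') \<and> \<not> cevian B'"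
  then have B': "distributive_lattice_zero B'" "\<not> cevian B'"
    by (simp_all add: completely_normal_def)
  show "\<not> homomorphic_image B' (Cs_c G)" if "l_group G"
    using l_group.cevian_image_Cs_c[OF that] B' by blast
  show "\<not> homomorphic_image B' (Id_c G)" if "representable G"
  proof -
    have "l_group G" using that by (simp add: representable_def)
    then show ?thesis using l_group.cevian_image_Id_c that B' by blast
  qed
qed

end
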